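(* Let $p_{s,t}:E\times E\to[0,\infty)$, $0\le s<t<T$, be the functions associated with $Z$, $b$ and $T$ as defined in the context. Suppose that they satisfy: (i) for all $0\le s<t<T$, the function $(x,y)\mapsto p_{s,t}(x,y)$ is measurable; (ii) for all $x\in E$ and $0\le s<t<T$, the function $y\mapsto p_{s,t}(x,y)$ is a probability density with respect to $\lambda$; (iii) for all $x,z\in E$ and $0\le s<t<u<T$, the Kolmogorov-Chapman equation $$p_{s,u}(x,z)=\int_E p_{s,t}(x,y)\,p_{t,u}(y,z)\,\lambda(dy)$$ holds. Then there exists a unique probability measure $\mathsf{P}^Z_{a,b,T}$ on $(E^{[0,T]},\mathcal{E}^{[0,T]})$ such that the coordinate process $(X_t)_{0\le t\le T}$ on $(E^{[0,T]},\mathcal{E}^{[0,T]})$ under $\mathsf{P}^Z_{a,b,T}$ is a bridge from $a$ to $b$ over $[0,T]$ derived from $Z$. Consequently, if $(Y_t)_{0\le t\le T}$ is a bridge from $a$ to $b$ over $[0,T]$ derived from $Z$, then its law on $(E^{[0,T]},\mathcal{E}^{[0,T]})$ is $\mathsf{P}^Z_{a,b,T}$.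
   Context: Let $E$ be a complete separable metric space with Borel $\sigma$-algebra $\mathcal{E}$, let $T>0$, let $a,b\in E$, and let $\lambda$ be a fixed $\sigma$-finite measure on $\mathcal{E}$. Let $(Z_t)_{0\le t\le T}$ be a time-homogeneous Markov process with state space $(E,\mathcal{E})$ admitting transition densities $(p^Z_t)_{0<t\le T}$ with respect to $\lambda$, i.e. $\mathsf{P}(Z_t\in A\mid Z_s)=\int_A p^Z_{t-s}(Z_s,y)\,\lambda(dy)$ $\mathsf{P}$-a.s. for all $A\in\mathcal{E}$, $0\le s<t\le T$. For $\varepsilon>0$, $B(b,\varepsilon)$ denotes the open ball in $E$ with centre $b$ and radius $\varepsilon$. For $x,y\in E$ and $0\le s<t<T$ define $$p_{s,t}(x,y):=p^Z_{t-s}(x,y)\lim_{\varepsilon\downarrow0}\frac{\int_{B(b,\varepsilon)}p^Z_{T-t}(y,z)\,\lambda(dz)}{\int_{B(b,\varepsilon)}p^Z_{T-s}(x,z)\,\lambda(dz)}$$ if the right hand side exists, and $p_{s,t}(x,y):=0$ otherwise. A bridge from $a$ to $b$ over $[0,T]$ derived from $Z$ is a (in general time-inhomogeneous) Markov process $(Y_t)_{0\le t\le T}$ with initial distribution $\mathsf{P}(Y_0=a)=1$, with $\mathsf{P}(Y_T=b)=1$, and with transition densities $(p_{s,t})_{0\le s<t<T}$ with respect to $\lambda$ (i.e. the conditional probability of $\{Y_t\in A\}$ given the past up to time $s$ is $\int_A p_{s,t}(Y_s,y)\,\lambda(dy)$ a.s., for $0\le s<t<T$, $A\in\mathcal{E}$).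 $\mathcal{E}^{[0,T]}$ denotes the product $\sigma$-algebra on $E^{[0,T]}$. *)

theory Defs
  imports "HOL-Probability.Probability"
begin

section \<open>Markov processes on a bounded time interval\<close>

definition gen_by :: "'w measure \<Rightarrow> (real \<Rightarrow> 'w \<Rightarrow> 'e::topological_space) \<Rightarrow> real set \<Rightarrow> 'w measure" where
  "gen_by M X I = sigma (space M) (\<Union>u\<in>I. {X u -` A \<inter> space M | A. A \<in> sets borel})"

definition cond_prob_in ::
    "'w measure \<Rightarrow> 'w measure \<Rightarrow> ('w \<Rightarrow> 'e) \<Rightarrow> 'e set \<Rightarrow> 'w \<Rightarrow> real" where
  "cond_prob_in M F V A = real_cond_exp M F (indicator {\<omega> \<in> space M. V \<omega> \<in> A})"

definition markov_process ::
    "'w measure \<Rightarrow> real \<Rightarrow> (real \<Rightarrow> 'w \<Rightarrow> 'e::topological_space) \<Rightarrow> bool" where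
  "markov_process M T X \<longleftrightarrow>
     prob_space M \<and>
     (\<forall>t\<in>{0..T}. X t \<in> M \<rightarrow>\<^sub>M borel) \<and>
     (\<forall>s t. 0 \<le> s \<and> s \<le> t \<and> t \<le> T \<longrightarrow>
       (\<forall>A\<in>sets borel. AE \<omega> in M.
          cond_prob_in M (gen_by M X {0..s}) (X t) A \<omega> = cond_prob_in M (gen_by M X {s}) (X t) A \<omega>))"

text \<open>
  Time-homogeneity is the fact that the density \<open>q (t - s)\<close> depends on \<open>s\<close> and \<open>t\<close> only
  through \<open>t - s\<close>. The set integral below is a Bochner integral, whose value is 0 for
  non-integrable functions; taking \<open>A = UNIV\<close> (conditional probability 1) shows that
  \<open>q (t - s) (X s \<omega>)\<close> is almost surely integrable, so no spurious case arises.
\<close>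

definition homogeneous_transition_densities ::
    "'w measure \<Rightarrow> real \<Rightarrow> (real \<Rightarrow> 'w \<Rightarrow> 'e::topological_space) \<Rightarrow> 'e measure
       \<Rightarrow> (real \<Rightarrow> 'e \<Rightarrow> 'e \<Rightarrow> real) \<Rightarrow> bool" where
  "homogeneous_transition_densities M T X \<mu> q \<longleftrightarrow>
     (\<forall>t. 0 < t \<and> t \<le> T \<longrightarrow>
        (\<forall>x y. 0 \<le> q t x y) \<and> (\<lambda>(x, y). q t x y) \<in> borel_measurable (borel \<Otimes>\<^sub>M borel)) \<and>
     (\<forall>s t. 0 \<le> s \<and> s < t \<and> t \<le> T \<longrightarrow>
       (\<forall>A\<in>sets borel. AE \<omega> in M.
          cond_prob_in M (gen_by M X {s}) (X t) A \<omega> = (LINT y:A|\<mu>. q (t - s) (X s \<omega>) y)))"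

section \<open>Bridges\<close>

text \<open>
  The limit in the definition of the bridge densities exists if, for all small \<open>\<epsilon> > 0\<close>, both
  integrals are finite and the denominator is non-zero (this excludes the convention
  \<open>x / 0 = 0\<close>), and the quotient has a limit in the reals.
\<close>

definition has_bridge_limit ::
    "'e::metric_space measure \<Rightarrow> (real \<Rightarrow> 'e \<Rightarrow> 'e \<Rightarrow> real) \<Rightarrow> real \<Rightarrow> 'e
       \<Rightarrow> real \<Rightarrow> real \<Rightarrow> 'e \<Rightarrow> 'e \<Rightarrow> real \<Rightarrow> bool" where
  "has_bridge_limit \<mu> q T b s t x y L \<longleftrightarrow>
     (\<forall>\<^sub>F \<epsilon> in at_right 0.
        set_integrable \<mu> (ball b \<epsilon>) (q (T - t) y) \<and>
        set_integrable \<mu> (ball b \<epsilon>) (q (T - s) x) \<and>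
        (LINT z:ball b \<epsilon>|\<mu>. q (T - s) x z) \<noteq> 0) \<and>
     ((\<lambda>\<epsilon>. (LINT z:ball b \<epsilon>|\<mu>. q (T - t) y z) / (LINT z:ball b \<epsilon>|\<mu>. q (T - s) x z))
        \<longlongrightarrow> L) (at_right 0)"

definition bridge_density ::
    "'e::metric_space measure \<Rightarrow> (real \<Rightarrow> 'e \<Rightarrow> 'e \<Rightarrow> real) \<Rightarrow> real \<Rightarrow> 'e
       \<Rightarrow> real \<Rightarrow> real \<Rightarrow> 'e \<Rightarrow> 'e \<Rightarrow> real" where
  "bridge_density \<mu> q T b s t x y =
     (if \<exists>L. has_bridge_limit \<mu> q T b s t x y L
      then q (t - s) x y * (THE L. has_bridge_limit \<mu> q T b s t x y L)
      else 0)"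

definition is_bridge ::
    "'e::metric_space measure \<Rightarrow> (real \<Rightarrow> 'e \<Rightarrow> 'e \<Rightarrow> real) \<Rightarrow> real \<Rightarrow> 'e \<Rightarrow> 'e
       \<Rightarrow> 'w measure \<Rightarrow> (real \<Rightarrow> 'w \<Rightarrow> 'e) \<Rightarrow> bool" where
  "is_bridge \<mu> q T a b M Y \<longleftrightarrow>
     markov_process M T Y \<and>
     \<P>(\<omega> in M. Y 0 \<omega> = a) = 1 \<and>
     \<P>(\<omega> in M. Y T \<omega> = b) = 1 \<and>
     (\<forall>s t. 0 \<le> s \<and> s < t \<and> t < T \<longrightarrow>
       (\<forall>A\<in>sets borel. AE \<omega> in M.
          cond_prob_in M (gen_by M Y {0..s}) (Y t) A \<omega> =
            (LINT y:A|\<mu>. bridge_density \<mu> q T b s t (Y s \<omega>) y)))"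

definition path_space :: "real \<Rightarrow> (real \<Rightarrow> 'e::topological_space) measure" where
  "path_space T = PiM {0..T} (\<lambda>_. borel)"

definition is_bridge_measure ::
    "'e::metric_space measure \<Rightarrow> (real \<Rightarrow> 'e \<Rightarrow> 'e \<Rightarrow> real) \<Rightarrow> real \<Rightarrow> 'e \<Rightarrow> 'e
       \<Rightarrow> (real \<Rightarrow> 'e) measure \<Rightarrow> bool" where
  "is_bridge_measure \<mu> q T a b P \<longleftrightarrow>
     prob_space P \<and> sets P = sets (path_space T) \<and> is_bridge \<mu> q T a b P (\<lambda>t \<omega>. \<omega> t)"

definition bridge_measure ::
    "'e::metric_space measure \<Rightarrow> (real \<Rightarrow> 'e \<Rightarrow> 'e \<Rightarrow> real) \<Rightarrow> real \<Rightarrow> 'e \<Rightarrow> 'e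
       \<Rightarrow> (real \<Rightarrow> 'e) measure" where
  "bridge_measure \<mu> q T a b = (THE P. is_bridge_measure \<mu> q T a b P)"

definition path_law :: "'w measure \<Rightarrow> real \<Rightarrow> (real \<Rightarrow> 'w \<Rightarrow> 'e::topological_space) \<Rightarrow> (real \<Rightarrow> 'e) measure" where
  "path_law M T Y = distr M (path_space T) (\<lambda>\<omega>. \<lambda>t\<in>{0..T}. Y t \<omega>)"

end

theory Submission
  imports Defs
begin

text \<open>
  A bridge is nothing but a Markov process started in \<open>a\<close> whose transition kernels over
  \<open>[0, T]\<close> are completely prescribed: between times \<open>s < t < T\<close> the kernel has density
  \<open>p s t\<close>, and from any time \<open>s < T\<close> to the terminal time \<open>T\<close> it is the point mass at
  \<open>b\<close>. Together with the trivial kernels for \<open>s = t\<close> these form a Chapman-Kolmogorov family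
  (\<open>pinned_kernel\<close>, \<open>is_bridge_iff_markov_from\<close>), for composing anything with the constant
  kernel \<open>\<delta>\<^sub>b\<close> gives \<open>\<delta>\<^sub>b\<close>. So no continuity at \<open>T\<close> has to be examined, and the problem becomes the
  construction and uniqueness of the law of a Markov process with given kernels and starting point.

  Uniqueness. Along times \<open>t\<^sub>1 < \<dots> < t\<^sub>n\<close> the Markov property integrates out the last
  time, then the one before it, and so on, which expresses the probability of every cylinder set
  through the kernels (\<open>markov_from_imp_has_fdd\<close>). Cylinders determine a measure on the product
  space, so the law of any bridge equals any other measure with these finite-dimensional
  distributions (\<open>path_law_eq\<close>).

  Existence. The same iterated integrals define a measure for every finite set of times. Inserting
  a time without imposing a constraint there does not change them, by Chapman-Kolmogorov
  (\<open>chain_integral_drop_UNIV\<close>); hence they are consistent and Kolmogorov's extension theorem for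
  Polish spaces applies (\<open>ex_measure_has_fdd\<close>). Under the resulting measure the coordinate
  process is Markov: the defining identity of the conditional probability given the past holds on
  cylinders by the formula for the finite-dimensional distributions, and then on the whole past
  because cylinders are stable under intersection (\<open>has_fdd_imp_markov_from\<close>).
\<close>

section \<open>The natural filtration and conditional probabilities\<close>

lemma sorted_le_last: "sorted ts \<Longrightarrow> r \<in> set ts \<Longrightarrow> r \<le> last ts"
  by (induction ts) auto

lemma emeasure_density_indicator:
  assumes "V \<in> sets N" "C \<in> sets N"
  shows "emeasure (density N (indicator V)) C = emeasure N (C \<inter> V)"
proof -
  have "(\<integral>\<^sup>+\<omega>. indicator V \<omega> * indicator C \<omega> \<partial>N) = (\<integral>\<^sup>+\<omega>. indicator (C \<inter> V) \<omega> \<partial>N)"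
    by (intro nn_integral_cong) (auto split: split_indicator)
  with assms show ?thesis by (simp add: emeasure_density)
qed

lemma space_gen_by [simp]: "space (gen_by M X I) = space M"
  by (simp add: gen_by_def space_measure_of_conv)

lemma sets_gen_by:
  "sets (gen_by M X I) =
     sigma_sets (space M) (\<Union>u\<in>I. {X u -` A \<inter> space M | A. A \<in> sets borel})"
  unfolding gen_by_def by (rule sets_measure_of) auto

lemma measurable_gen_by: "u \<in> I \<Longrightarrow> X u \<in> gen_by M X I \<rightarrow>\<^sub>M borel"
  by (rule measurableI) (auto simp: sets_gen_by)

lemma subalgebra_gen_by:
  assumes "\<And>u. u \<in> I \<Longrightarrow> X u \<in> M \<rightarrow>\<^sub>M borel"
  shows "subalgebra M (gen_by M X I)"
  unfolding subalgebra_def sets_gen_by using assms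
  by (auto intro!: sets.sigma_sets_subset measurable_sets)

lemma sets_gen_by_mono: "I \<subseteq> J \<Longrightarrow> sets (gen_by M X I) \<subseteq> sets (gen_by M X J)"
  unfolding sets_gen_by by (intro sigma_sets_mono') blast

lemma measurable_cylinder:
  assumes "finite J" "\<And>t. t \<in> J \<Longrightarrow> Y t \<in> N \<rightarrow>\<^sub>M borel" "\<And>t. t \<in> J \<Longrightarrow> A t \<in> sets borel"
  shows "{\<omega> \<in> space N. \<forall>t\<in>J. Y t \<omega> \<in> A t} \<in> sets N"
  using assms by measurable

text \<open>
  The distinguished time \<open>s\<close> always belongs to the constrained times, possibly with the trivial
  constraint. With \<open>s\<close> the right end point of \<open>I\<close>, the present is then the last time of the list
  along which the finite-dimensional distributions are evaluated.
\<close>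

definition cylinders ::
    "'w measure \<Rightarrow> (real \<Rightarrow> 'w \<Rightarrow> 'e::topological_space) \<Rightarrow> real set \<Rightarrow> real \<Rightarrow> 'w set set" where
  "cylinders M X I s = {{\<omega> \<in> space M. \<forall>r\<in>J. X r \<omega> \<in> C r} | J C.
     finite J \<and> s \<in> J \<and> J \<subseteq> I \<and> (\<forall>r\<in>J. C r \<in> sets borel)}"

lemma Int_stable_cylinders: "Int_stable (cylinders M X I s)"
proof (rule Int_stableI)
  fix a b assume "a \<in> cylinders M X I s" "b \<in> cylinders M X I s"
  then obtain J C J' C' where
    J: "finite J" "s \<in> J" "J \<subseteq> I" "\<forall>r\<in>J. C r \<in> sets borel"
      "a = {\<omega> \<in> space M. \<forall>r\<in>J. X r \<omega> \<in> C r}" and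
    J': "finite J'" "s \<in> J'" "J' \<subseteq> I" "\<forall>r\<in>J'. C' r \<in> sets borel"
      "b = {\<omega> \<in> space M. \<forall>r\<in>J'. X r \<omega> \<in> C' r}"
    unfolding cylinders_def by blast
  let ?D = "\<lambda>r. (if r \<in> J then C r else UNIV) \<inter> (if r \<in> J' then C' r else UNIV)"
  have "a \<inter> b = {\<omega> \<in> space M. \<forall>r\<in>J \<union> J'. X r \<omega> \<in> ?D r}"
    using J J' by auto
  moreover have "\<forall>r\<in>J \<union> J'. ?D r \<in> sets borel"
    using J J' by auto
  ultimately show "a \<inter> b \<in> cylinders M X I s"
    unfolding cylinders_def using J J'
    by (intro CollectI exI[of _ "J \<union> J'"] exI[of _ ?D]) simp
qed

lemma space_in_cylinders: "s \<in> I \<Longrightarrow> space M \<in> cylinders M X I s"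
  unfolding cylinders_def by (intro CollectI exI[of _ "{s}"] exI[of _ "\<lambda>_. UNIV"]) auto

lemma sets_gen_by_cylinders:
  assumes "s \<in> I"
  shows "sets (gen_by M X I) = sigma_sets (space M) (cylinders M X I s)"
proof
  show "sets (gen_by M X I) \<subseteq> sigma_sets (space M) (cylinders M X I s)"
    unfolding sets_gen_by
  proof (rule sigma_sets_mono', safe)
    fix u A assume "u \<in> I" "(A :: 'b set) \<in> sets borel"
    then show "X u -` A \<inter> space M \<in> cylinders M X I s"
      unfolding cylinders_def using assms
      by (intro CollectI exI[of _ "{u, s}"] exI[of _ "\<lambda>r. if r = u then A else UNIV"]) auto
  qed
  show "sigma_sets (space M) (cylinders M X I s) \<subseteq> sets (gen_by M X I)"
  proof -
    have "cylinders M X I s \<subseteq> sets (gen_by M X I)"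
    proof
      fix c assume "c \<in> cylinders M X I s"
      then obtain J C where J: "finite J" "J \<subseteq> I" "\<forall>r\<in>J. C r \<in> sets borel"
        and c: "c = {\<omega> \<in> space M. \<forall>r\<in>J. X r \<omega> \<in> C r}"
        unfolding cylinders_def by blast
      have "X r \<in> gen_by M X I \<rightarrow>\<^sub>M borel" if "r \<in> J" for r
        using J that by (intro measurable_gen_by) auto
      then show "c \<in> sets (gen_by M X I)"
        using measurable_cylinder[of J X "gen_by M X I" C] J by (simp add: c)
    qed
    from sets.sigma_sets_subset[OF this] show ?thesis by simp
  qed
qed

text \<open>
  A version of a conditional probability is recognised by its integrals over the sets of the
  sub-\<open>\<sigma>\<close>-algebra. The Markov property is therefore treated below as an identity
  of integrals; one direction translates it back into conditional probabilities for the constructed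
  measure, the other extracts it from a given bridge.
\<close>

lemma cond_prob_in_iff:
  assumes N: "prob_space N" and F: "subalgebra N F"
    and V: "V \<in> N \<rightarrow>\<^sub>M borel" "A \<in> sets borel"
    and h: "h \<in> borel_measurable F" "\<And>\<omega>. 0 \<le> h \<omega>" "\<And>\<omega>. h \<omega> \<le> 1"
  shows "(AE \<omega> in N. cond_prob_in N F V A \<omega> = h \<omega>) \<longleftrightarrow>
    (\<forall>B\<in>sets F. emeasure N (B \<inter> {\<omega> \<in> space N. V \<omega> \<in> A}) = (\<integral>\<^sup>+\<omega>\<in>B. ennreal (h \<omega>) \<partial>N))"
proof -
  interpret prob_space N by fact
  interpret finite_measure_subalgebra N F by standard fact
  note [measurable] = V
  have [measurable]: "h \<in> borel_measurable N" by (rule measurable_from_subalg[OF F h(1)])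
  let ?V = "{\<omega> \<in> space N. V \<omega> \<in> A}"
  have int_h: "integrable N h"
    by (rule integrable_const_bound[of _ 1]) (auto simp: h)
  have int_V: "integrable N (indicat_real ?V)"
    by (rule integrable_const_bound[of _ 1]) auto
  have FN: "B \<in> sets N" if "B \<in> sets F" for B
    using F that unfolding subalgebra_def by auto
  have eq: "emeasure N (B \<inter> ?V) = (\<integral>\<^sup>+\<omega>\<in>B. ennreal (h \<omega>) \<partial>N) \<longleftrightarrow>
      (\<integral>\<omega>\<in>B. indicat_real ?V \<omega> \<partial>N) = (\<integral>\<omega>\<in>B. h \<omega> \<partial>N)" if "B \<in> sets F" for B
  proof -
    have [measurable]: "B \<in> sets N" using FN that .
    have "(\<integral>\<^sup>+\<omega>\<in>B. ennreal (h \<omega>) \<partial>N) = (\<integral>\<^sup>+\<omega>. ennreal (indicator B \<omega> * h \<omega>) \<partial>N)"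
      by (intro nn_integral_cong) (auto split: split_indicator)
    also have "\<dots> = ennreal (\<integral>\<omega>\<in>B. h \<omega> \<partial>N)"
      unfolding set_lebesgue_integral_def real_scaleR_def
      using integrable_mult_indicator[OF _ int_h, of B] h
      by (intro nn_integral_eq_integral) auto
    finally have 1: "(\<integral>\<^sup>+\<omega>\<in>B. ennreal (h \<omega>) \<partial>N) = ennreal (\<integral>\<omega>\<in>B. h \<omega> \<partial>N)" .
    have "(\<integral>\<omega>\<in>B. indicat_real ?V \<omega> \<partial>N) = (\<integral>\<omega>. indicat_real (B \<inter> ?V) \<omega> \<partial>N)"
      unfolding set_lebesgue_integral_def
      by (intro Bochner_Integration.integral_cong) (auto split: split_indicator)
    also have "\<dots> = measure N (B \<inter> ?V)" by simp
    finally have 2: "(\<integral>\<omega>\<in>B. indicat_real ?V \<omega> \<partial>N) = measure N (B \<inter> ?V)" .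
    have "0 \<le> (\<integral>\<omega>\<in>B. h \<omega> \<partial>N)"
      unfolding set_lebesgue_integral_def using h by (intro integral_nonneg_AE) simp
    then show ?thesis unfolding 1 2 by (simp add: emeasure_eq_measure)
  qed
  have "(AE \<omega> in N. real_cond_exp N F (indicat_real ?V) \<omega> = h \<omega>) \<longleftrightarrow>
    (\<forall>B\<in>sets F. (\<integral>\<omega>\<in>B. indicat_real ?V \<omega> \<partial>N) = (\<integral>\<omega>\<in>B. h \<omega> \<partial>N))"
  proof safe
    fix B assume ae: "AE \<omega> in N. real_cond_exp N F (indicat_real ?V) \<omega> = h \<omega>" and B: "B \<in> sets F"
    have [measurable]: "B \<in> sets N" using FN B .
    have "(\<integral>\<omega>\<in>B. indicat_real ?V \<omega> \<partial>N) = (\<integral>\<omega>\<in>B. real_cond_exp N F (indicat_real ?V) \<omega> \<partial>N)"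
      by (rule real_cond_exp_intA[OF int_V B])
    also have "\<dots> = (\<integral>\<omega>\<in>B. h \<omega> \<partial>N)"
      unfolding set_lebesgue_integral_def using ae by (intro integral_cong_AE) auto
    finally show "(\<integral>\<omega>\<in>B. indicat_real ?V \<omega> \<partial>N) = (\<integral>\<omega>\<in>B. h \<omega> \<partial>N)" .
  next
    assume "\<forall>B\<in>sets F. (\<integral>\<omega>\<in>B. indicat_real ?V \<omega> \<partial>N) = (\<integral>\<omega>\<in>B. h \<omega> \<partial>N)"
    then show "AE \<omega> in N. real_cond_exp N F (indicat_real ?V) \<omega> = h \<omega>"
      by (intro real_cond_exp_charact int_V int_h h(1)) auto
  qed
  then show ?thesis unfolding cond_prob_in_def using eq by auto
qed

section \<open>Families of Markov kernels on a time interval\<close>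

text \<open>
  The end points \<open>s = t\<close> and \<open>t = T\<close> are included, so that the state at the starting time and
  at the terminal time needs no special treatment.
\<close>

locale markov_kernels =
  fixes T :: real and K :: "real \<Rightarrow> real \<Rightarrow> 'e::polish_space \<Rightarrow> 'e measure"
  assumes T_nonneg: "0 \<le> T"
    and kernel: "\<And>s t. 0 \<le> s \<Longrightarrow> s \<le> t \<Longrightarrow> t \<le> T \<Longrightarrow> K s t \<in> borel \<rightarrow>\<^sub>M prob_algebra borel"
    and kernel_refl: "\<And>s x. 0 \<le> s \<Longrightarrow> s \<le> T \<Longrightarrow> K s s x = return borel x"
    and chapman_kolmogorov: "\<And>s t u x. 0 \<le> s \<Longrightarrow> s \<le> t \<Longrightarrow> t \<le> u \<Longrightarrow> u \<le> T \<Longrightarrow>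
      K s t x \<bind> K t u = K s u x"
begin

lemma kernel_subprob: "0 \<le> s \<Longrightarrow> s \<le> t \<Longrightarrow> t \<le> T \<Longrightarrow> K s t \<in> borel \<rightarrow>\<^sub>M subprob_algebra borel"
  by (intro measurable_prob_algebraD kernel)

lemma sets_kernel: "0 \<le> s \<Longrightarrow> s \<le> t \<Longrightarrow> t \<le> T \<Longrightarrow> sets (K s t x) = sets borel"
  using measurable_space[OF kernel, of s t x] by (simp add: space_prob_algebra)

lemma prob_space_kernel: "0 \<le> s \<Longrightarrow> s \<le> t \<Longrightarrow> t \<le> T \<Longrightarrow> prob_space (K s t x)"
  using measurable_space[OF kernel, of s t x] by (simp add: space_prob_algebra)

lemma borel_measurable_kernel_integral:
  assumes "0 \<le> s" "s \<le> t" "t \<le> T" and [measurable]: "h \<in> borel_measurable borel"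
  shows "(\<lambda>x. \<integral>\<^sup>+y. h y \<partial>K s t x) \<in> borel_measurable borel"
  by (rule nn_integral_measurable_subprob_algebra2[OF _ kernel_subprob[OF assms(1-3)]]) measurable

text \<open>
  For times \<open>s \<le> t\<^sub>1 \<le> \<dots> \<le> t\<^sub>n\<close> this is the expectation of
  \<open>1\<^bsub>A t\<^sub>1\<^esub>(X t\<^sub>1) \<dots> 1\<^bsub>A t\<^sub>n\<^esub>(X t\<^sub>n) g(X t\<^sub>n)\<close> for a Markov process that is in \<open>x\<close> at time \<open>s\<close>. The
  recursion conditions on the first time; the test function \<open>g\<close> at the last time makes it possible
  to remove times from the other end as well (\<open>chain_integral_snoc\<close>).
\<close>

primrec chain_integral ::
    "(real \<Rightarrow> 'e set) \<Rightarrow> ('e \<Rightarrow> ennreal) \<Rightarrow> real list \<Rightarrow> real \<Rightarrow> 'e \<Rightarrow> ennreal" where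
  "chain_integral A g [] s x = g x"
| "chain_integral A g (t # ts) s x =
     (\<integral>\<^sup>+y. indicator (A t) y * chain_integral A g ts t y \<partial>K s t x)"

lemma borel_measurable_chain_integral:
  assumes "sorted (s # ts)" "set (s # ts) \<subseteq> {0..T}"
    and "\<And>t. t \<in> set ts \<Longrightarrow> A t \<in> sets borel" "g \<in> borel_measurable borel"
  shows "chain_integral A g ts s \<in> borel_measurable borel"
  using assms
proof (induction ts arbitrary: s)
  case Nil
  then show ?case by (simp add: fun_eq_iff[symmetric] cong: measurable_cong)
next
  case (Cons t ts)
  then have [measurable]: "chain_integral A g ts t \<in> borel_measurable borel"
    by simp
  have [measurable]: "A t \<in> sets borel" using Cons by simp
  show ?case using Cons.prems
    by (auto intro!: borel_measurable_kernel_integral)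
qed

lemma chain_integral_cong:
  "(\<And>t. t \<in> set ts \<Longrightarrow> A t = B t) \<Longrightarrow> chain_integral A g ts s x = chain_integral B g ts s x"
  by (induction ts arbitrary: s x) auto

text \<open>
  The last transition can be absorbed into the test function at the time before. This is the form in
  which the iterated integral meets the Markov property, which conditions on the past.
\<close>

lemma chain_integral_snoc:
  "chain_integral A g (ts @ [t]) s x =
     chain_integral A (\<lambda>y. \<integral>\<^sup>+z. indicator (A t) z * g z \<partial>K (last (s # ts)) t y) ts s x"
  by (induction ts arbitrary: s x) auto

text \<open>
  Consistency of the finite-dimensional distributions: at an unconstrained time the two adjacent
  kernels compose by Chapman-Kolmogorov, and an unconstrained last time integrates to one. Discarding
  all such times at once allows two lists of times to be compared through their common reduced list.
\<close>

lemma chain_integral_drop_UNIV: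
  assumes "sorted (s # ts)" "set (s # ts) \<subseteq> {0..T}" "\<And>t. t \<in> set ts \<Longrightarrow> A t \<in> sets borel"
  shows "chain_integral A (\<lambda>_. 1) (filter (\<lambda>t. A t \<noteq> UNIV) ts) s x =
    chain_integral A (\<lambda>_. 1) ts s x"
  using assms
proof (induction ts arbitrary: s x)
  case (Cons t ts)
  have st: "0 \<le> s" "s \<le> t" "t \<le> T" using Cons.prems by auto
  show ?case
  proof (cases "A t = UNIV")
    case False
    then show ?thesis using Cons by (auto intro!: nn_integral_cong)
  next
    case True
    have IH: "chain_integral A (\<lambda>_. 1) (filter (\<lambda>t. A t \<noteq> UNIV) ts) s x =
      chain_integral A (\<lambda>_. 1) ts s x"
      using Cons.prems by (intro Cons.IH) auto
    have "chain_integral A (\<lambda>_. 1) ts s x = (\<integral>\<^sup>+y. chain_integral A (\<lambda>_. 1) ts t y \<partial>K s t x)"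
    proof (cases ts)
      case Nil
      then show ?thesis using prob_space.emeasure_space_1[OF prob_space_kernel[OF st]] by simp
    next
      case (Cons u us)
      have tu: "t \<le> u" "u \<le> T" using Cons.prems Cons by auto
      have [measurable]: "A u \<in> sets borel" "chain_integral A (\<lambda>_. 1) us u \<in> borel_measurable borel"
        using Cons.prems Cons by (auto simp: subset_eq intro!: borel_measurable_chain_integral)
      have "chain_integral A (\<lambda>_. 1) ts s x =
          (\<integral>\<^sup>+z. indicator (A u) z * chain_integral A (\<lambda>_. 1) us u z \<partial>(K s t x \<bind> K t u))"
        using st tu by (simp add: Cons chapman_kolmogorov)
      also have "\<dots> = (\<integral>\<^sup>+y. \<integral>\<^sup>+z. indicator (A u) z * chain_integral A (\<lambda>_. 1) us u z \<partial>K t u y \<partial>K s t x)"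
        using st tu
        by (intro nn_integral_bind[where B = borel])
           (auto simp: measurable_cong_sets[OF sets_kernel refl] intro!: kernel_subprob)
      also have "\<dots> = (\<integral>\<^sup>+y. chain_integral A (\<lambda>_. 1) ts t y \<partial>K s t x)"
        by (intro nn_integral_cong) (simp add: Cons)
      finally show ?thesis .
    qed
    with IH True show ?thesis by simp
  qed
qed simp

section \<open>The Markov property and the finite-dimensional distributions\<close>

text \<open>
  The test function \<open>g\<close> is evaluated at the last time of the list, which is therefore required to be
  nonempty. Admitting functions there, and not only constraint sets, allows a further transition from
  that time to be integrated out, with \<open>g\<close> a transition probability.
\<close>

definition has_fdd :: "'w measure \<Rightarrow> (real \<Rightarrow> 'w \<Rightarrow> 'e) \<Rightarrow> 'e \<Rightarrow> bool" where
  "has_fdd N Y a \<longleftrightarrow> prob_space N \<and> (\<forall>t\<in>{0..T}. Y t \<in> N \<rightarrow>\<^sub>M borel) \<and>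
     (\<forall>ts A g. ts \<noteq> [] \<longrightarrow> sorted_wrt (<) ts \<longrightarrow> set ts \<subseteq> {0..T} \<longrightarrow>
        (\<forall>t\<in>set ts. A t \<in> sets borel) \<longrightarrow> g \<in> borel_measurable borel \<longrightarrow>
        (\<integral>\<^sup>+\<omega>\<in>{\<omega> \<in> space N. \<forall>t\<in>set ts. Y t \<omega> \<in> A t}. g (Y (last ts) \<omega>) \<partial>N) =
          chain_integral A g ts 0 a)"

lemma has_fddD:
  assumes "has_fdd N Y a" "ts \<noteq> []" "sorted_wrt (<) ts" "set ts \<subseteq> {0..T}"
    "\<And>t. t \<in> set ts \<Longrightarrow> A t \<in> sets borel" "g \<in> borel_measurable borel"
  shows "(\<integral>\<^sup>+\<omega>\<in>{\<omega> \<in> space N. \<forall>t\<in>set ts. Y t \<omega> \<in> A t}. g (Y (last ts) \<omega>) \<partial>N) =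
          chain_integral A g ts 0 a"
  using assms unfolding has_fdd_def by blast

lemma has_fdd_emeasure_cylinder:
  assumes fdd: "has_fdd N Y a" and J: "finite J" "J \<subseteq> {0..T}"
    and A: "\<And>t. t \<in> J \<Longrightarrow> A t \<in> sets borel"
  shows "emeasure N {\<omega> \<in> space N. \<forall>t\<in>J. Y t \<omega> \<in> A t} =
    chain_integral A (\<lambda>_. 1) (sorted_list_of_set J) 0 a"
proof (cases "J = {}")
  case True
  with fdd show ?thesis by (simp add: has_fdd_def prob_space.emeasure_space_1)
next
  case False
  have "{\<omega> \<in> space N. \<forall>t\<in>J. Y t \<omega> \<in> A t} \<in> sets N"
    using fdd J A by (intro measurable_cylinder) (auto simp: has_fdd_def)
  then have "emeasure N {\<omega> \<in> space N. \<forall>t\<in>J. Y t \<omega> \<in> A t} =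
    (\<integral>\<^sup>+\<omega>\<in>{\<omega> \<in> space N. \<forall>t\<in>J. Y t \<omega> \<in> A t}. 1 \<partial>N)" by simp
  then show ?thesis
    using has_fddD[OF fdd, of "sorted_list_of_set J" A "\<lambda>_. 1"] J A False by simp
qed

text \<open>
  The Markov property relative to the whole past, started in \<open>a\<close>, in integrated form: by
  \<open>cond_prob_in_iff\<close> it says that the conditional probability of \<open>{Y t \<in> A}\<close> given the past up to
  \<open>s\<close> is \<open>K s t (Y s) A\<close>.
\<close>

definition markov_from :: "'w measure \<Rightarrow> (real \<Rightarrow> 'w \<Rightarrow> 'e) \<Rightarrow> 'e \<Rightarrow> bool" where
  "markov_from N Y a \<longleftrightarrow> prob_space N \<and> (\<forall>t\<in>{0..T}. Y t \<in> N \<rightarrow>\<^sub>M borel) \<and>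
     (AE \<omega> in N. Y 0 \<omega> = a) \<and>
     (\<forall>s t. 0 \<le> s \<longrightarrow> s \<le> t \<longrightarrow> t \<le> T \<longrightarrow>
        (\<forall>A\<in>sets borel. \<forall>B\<in>sets (gen_by N Y {0..s}).
           emeasure N (B \<inter> {\<omega> \<in> space N. Y t \<omega> \<in> A}) =
             (\<integral>\<^sup>+\<omega>\<in>B. emeasure (K s t (Y s \<omega>)) A \<partial>N)))"

text \<open>
  Both sides, as functions of the set \<open>A\<close> in the Markov property, are measures: on the event
  \<open>B\<close>, the law of \<open>Y t\<close> is the law of \<open>Y s\<close> followed by the kernel. Equal measures integrate every
  \<open>g\<close> equally.
\<close>

lemma markov_from_nn_integral:
  assumes mk: "markov_from N Y a" and st: "0 \<le> s" "s \<le> t" "t \<le> T"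
    and B: "B \<in> sets (gen_by N Y {0..s})" and g: "g \<in> borel_measurable borel"
  shows "(\<integral>\<^sup>+\<omega>\<in>B. g (Y t \<omega>) \<partial>N) = (\<integral>\<^sup>+\<omega>\<in>B. (\<integral>\<^sup>+y. g y \<partial>K s t (Y s \<omega>)) \<partial>N)"
proof -
  have [measurable]: "Y s \<in> N \<rightarrow>\<^sub>M borel" "Y t \<in> N \<rightarrow>\<^sub>M borel"
    using mk st by (auto simp: markov_from_def)
  have [measurable]: "B \<in> sets N"
    using subalgebra_gen_by[of "{0..s}" Y N] mk st B by (auto simp: markov_from_def subalgebra_def)
  note [measurable] = g kernel_subprob[OF st] borel_measurable_kernel_integral[OF st g]
  let ?D = "density N (indicator B)"
  have "distr ?D borel (Y t) = distr ?D borel (Y s) \<bind> K s t"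
  proof (rule measure_eqI)
    fix A assume "A \<in> sets (distr ?D borel (Y t))"
    then have [measurable]: "A \<in> sets borel" by simp
    have "emeasure (distr ?D borel (Y t)) A = emeasure N (B \<inter> {\<omega> \<in> space N. Y t \<omega> \<in> A})"
      by (simp add: emeasure_distr emeasure_density_indicator vimage_def Int_def conj_ac)
    also have "\<dots> = (\<integral>\<^sup>+\<omega>\<in>B. emeasure (K s t (Y s \<omega>)) A \<partial>N)"
      using mk st B \<open>A \<in> sets borel\<close> unfolding markov_from_def by blast
    also have "\<dots> = emeasure (distr ?D borel (Y s) \<bind> K s t) A"
      by (subst emeasure_bind[where N = borel])
         (auto simp: nn_integral_distr nn_integral_density mult.commute)
    finally show "emeasure (distr ?D borel (Y t)) A = emeasure (distr ?D borel (Y s) \<bind> K s t) A" .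
  qed (simp add: sets_bind[where N = borel] sets_kernel[OF st])
  then have "(\<integral>\<^sup>+y. g y \<partial>distr ?D borel (Y t)) = (\<integral>\<^sup>+y. g y \<partial>(distr ?D borel (Y s) \<bind> K s t))"
    by simp
  also have "\<dots> = (\<integral>\<^sup>+x. \<integral>\<^sup>+y. g y \<partial>K s t x \<partial>distr ?D borel (Y s))"
    by (rule nn_integral_bind[where B = borel]) measurable
  finally show ?thesis
    by (simp add: nn_integral_distr nn_integral_density mult.commute)
qed

text \<open>
  Induction on the list of times from its right end. The Markov property at the last but one time
  replaces the last coordinate by its conditional expectation, which is a new test function at the
  last but one time; this is why the statement has to hold for all test functions \<open>g\<close>.
\<close>

lemma markov_from_imp_has_fdd:
  assumes mk: "markov_from N Y a"
  shows "has_fdd N Y a"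
proof -
  interpret prob_space N using mk by (simp add: markov_from_def)
  have Y: "Y t \<in> N \<rightarrow>\<^sub>M borel" if "t \<in> {0..T}" for t
    using mk that by (auto simp: markov_from_def)
  \<comment> \<open>Prepending the time \<open>0\<close> gives the empty list a last time, so that the induction can start from
    the known initial state.\<close>
  have "(\<integral>\<^sup>+\<omega>\<in>{\<omega> \<in> space N. \<forall>t\<in>set ts. Y t \<omega> \<in> A t}. g (Y (last (0 # ts)) \<omega>) \<partial>N) =
          chain_integral A g ts 0 a"
    if "sorted ts" "set ts \<subseteq> {0..T}" "\<forall>t\<in>set ts. A t \<in> sets borel" "g \<in> borel_measurable borel"
    for ts A g
    using that
  proof (induction ts arbitrary: g rule: rev_induct)
    case Nil
    have "(\<integral>\<^sup>+\<omega>. g (Y 0 \<omega>) * indicator (space N) \<omega> \<partial>N) = (\<integral>\<^sup>+\<omega>. g a \<partial>N)"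
      using mk by (intro nn_integral_cong_AE) (auto simp: markov_from_def)
    then show ?case by (simp add: emeasure_space_1)
  next
    case (snoc t ts)
    let ?s = "last (0 # ts)"
    let ?B = "{\<omega> \<in> space N. \<forall>r\<in>set ts. Y r \<omega> \<in> A r}"
    have s: "r \<le> ?s" if "r \<in> set ts" for r
      using snoc.prems that by (auto simp: sorted_append intro: sorted_le_last)
    have st: "0 \<le> ?s" "?s \<le> t" "t \<le> T"
      using snoc.prems subsetD[OF _ last_in_set[of ts], of "{0..T}"] T_nonneg
      by (auto simp: sorted_append)
    have [measurable]: "A t \<in> sets borel" "g \<in> borel_measurable borel" using snoc.prems by auto
    have B: "?B \<in> sets (gen_by N Y {0..?s})"
    proof -
      have "Y r \<in> gen_by N Y {0..?s} \<rightarrow>\<^sub>M borel" if "r \<in> set ts" for r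
        using that snoc.prems s by (intro measurable_gen_by) auto
      then show ?thesis
        using measurable_cylinder[of "set ts" Y "gen_by N Y {0..?s}" A] snoc.prems by simp
    qed
    have "(\<integral>\<^sup>+\<omega>\<in>{\<omega> \<in> space N. \<forall>r\<in>set (ts @ [t]). Y r \<omega> \<in> A r}. g (Y (last (0 # ts @ [t])) \<omega>) \<partial>N) =
        (\<integral>\<^sup>+\<omega>\<in>?B. (indicator (A t) (Y t \<omega>) * g (Y t \<omega>)) \<partial>N)"
      by (intro nn_integral_cong) (auto split: split_indicator)
    also have "\<dots> = (\<integral>\<^sup>+\<omega>\<in>?B. (\<integral>\<^sup>+z. indicator (A t) z * g z \<partial>K ?s t (Y ?s \<omega>)) \<partial>N)"
      by (rule markov_from_nn_integral[OF mk st B]) measurable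
    also have "\<dots> = chain_integral A (\<lambda>y. \<integral>\<^sup>+z. indicator (A t) z * g z \<partial>K ?s t y) ts 0 a"
      using snoc.prems st by (intro snoc.IH borel_measurable_kernel_integral[OF st]) (auto simp: sorted_append)
    finally show ?case by (simp only: chain_integral_snoc)
  qed
  note fdd = this
  have "(\<integral>\<^sup>+\<omega>\<in>{\<omega> \<in> space N. \<forall>t\<in>set ts. Y t \<omega> \<in> A t}. g (Y (last ts) \<omega>) \<partial>N) =
          chain_integral A g ts 0 a"
    if "ts \<noteq> []" "sorted_wrt (<) ts" "set ts \<subseteq> {0..T}" "\<forall>t\<in>set ts. A t \<in> sets borel"
      "g \<in> borel_measurable borel" for ts A g
    using fdd[of ts A g] that by (simp add: strict_sorted_iff)
  then show ?thesis
    using Y prob_space_axioms unfolding has_fdd_def by blast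
qed

text \<open>
  For fixed \<open>s\<close>, \<open>t\<close> and \<open>A\<close> both sides of the Markov property are finite measures in the event
  \<open>B\<close> of the past. On a cylinder \<open>B\<close> whose last time is \<open>s\<close> they agree: appending the time \<open>t\<close> with
  constraint \<open>A\<close> to the list of times amounts to the test function \<open>K s t _ A\<close> at time \<open>s\<close>. Such
  cylinders generate the past and are stable under intersection.
\<close>

lemma has_fdd_imp_markov_from:
  assumes fdd: "has_fdd N Y a"
  shows "markov_from N Y a"
proof -
  interpret prob_space N using fdd by (simp add: has_fdd_def)
  have Y: "Y t \<in> N \<rightarrow>\<^sub>M borel" if "t \<in> {0..T}" for t
    using fdd that by (auto simp: has_fdd_def)
  have [measurable]: "Y 0 \<in> N \<rightarrow>\<^sub>M borel" using Y T_nonneg by auto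
  have "emeasure N {\<omega> \<in> space N. Y 0 \<omega> \<in> {a}} = 1"
    using has_fdd_emeasure_cylinder[OF fdd, of "{0}" "\<lambda>_. {a}"] T_nonneg
    by (simp add: kernel_refl nn_integral_return)
  then have start: "AE \<omega> in N. Y 0 \<omega> = a"
    by (simp add: emeasure_eq_measure prob_Collect_eq_1)
  have "emeasure N (B \<inter> {\<omega> \<in> space N. Y t \<omega> \<in> A}) =
             (\<integral>\<^sup>+\<omega>\<in>B. emeasure (K s t (Y s \<omega>)) A \<partial>N)"
    if st: "0 \<le> s" "s \<le> t" "t \<le> T" and A: "A \<in> sets borel" and B: "B \<in> sets (gen_by N Y {0..s})"
    for s t A B
  proof -
    let ?F = "gen_by N Y {0..s}" and ?V = "{\<omega> \<in> space N. Y t \<omega> \<in> A}"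
    let ?h = "\<lambda>\<omega>. emeasure (K s t (Y s \<omega>)) A"
    note [measurable] = A Y[of s] Y[of t] kernel_subprob[OF st]
    have [measurable]: "Y s \<in> N \<rightarrow>\<^sub>M borel" "Y t \<in> N \<rightarrow>\<^sub>M borel" using Y st by auto
    have sub: "subalgebra N ?F" using Y st by (intro subalgebra_gen_by) auto
    then have FN: "C \<in> sets N" if "C \<in> sets ?F" for C using that by (auto simp: subalgebra_def)
    have sub1: "subalgebra (density N (indicator ?V)) ?F" "subalgebra (density N ?h) ?F"
      using sub by (auto simp: subalgebra_def)
    have e1: "emeasure (density N (indicator ?V)) C = emeasure N (C \<inter> ?V)" if "C \<in> sets ?F" for C
    proof -
      have [measurable]: "C \<in> sets N" using FN that .
      show ?thesis by (simp add: emeasure_density_indicator)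
    qed
    have e2: "emeasure (density N ?h) C = (\<integral>\<^sup>+\<omega>\<in>C. ?h \<omega> \<partial>N)" if "C \<in> sets ?F" for C
      using FN[OF that] by (simp add: emeasure_density)
    have s: "s \<in> {0..s}" using st by simp
    have "restr_to_subalg (density N (indicator ?V)) ?F = restr_to_subalg (density N ?h) ?F"
    proof (rule measure_eqI_generator_eq[OF Int_stable_cylinders])
      show "range (\<lambda>_::nat. space N) \<subseteq> cylinders N Y {0..s} s"
        using space_in_cylinders[OF s] by auto
      show "cylinders N Y {0..s} s \<subseteq> Pow (space N)" by (auto simp: cylinders_def)
      show "sets (restr_to_subalg (density N (indicator ?V)) ?F) =
          sigma_sets (space N) (cylinders N Y {0..s} s)"
        "sets (restr_to_subalg (density N ?h) ?F) = sigma_sets (space N) (cylinders N Y {0..s} s)"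
        using sets_gen_by_cylinders[OF s, of N Y] sub1 by (simp_all add: sets_restr_to_subalg)
      show "emeasure (restr_to_subalg (density N (indicator ?V)) ?F) (space N) \<noteq> \<infinity>"
        using sub1 e1[of "space N"] sets.top[of ?F]
        by (simp add: emeasure_restr_to_subalg)
      fix C assume C: "C \<in> cylinders N Y {0..s} s"
      then have CF: "C \<in> sets ?F" by (simp add: sets_gen_by_cylinders[OF s])
      obtain J D where J: "finite J" "s \<in> J" "J \<subseteq> {0..s}" "\<forall>r\<in>J. D r \<in> sets borel"
        and C_eq: "C = {\<omega> \<in> space N. \<forall>r\<in>J. Y r \<omega> \<in> D r}"
        using C unfolding cylinders_def by blast
      have "emeasure N (C \<inter> ?V) = (\<integral>\<^sup>+\<omega>\<in>C. ?h \<omega> \<partial>N)"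
      proof (cases "s = t")
        case True
        then have h: "?h \<omega> = indicator A (Y t \<omega>)" for \<omega>
          using st by (simp add: kernel_refl)
        have "emeasure N (C \<inter> ?V) = (\<integral>\<^sup>+\<omega>. indicator (C \<inter> ?V) \<omega> \<partial>N)"
          using FN[OF CF] by simp
        also have "\<dots> = (\<integral>\<^sup>+\<omega>\<in>C. ?h \<omega> \<partial>N)"
          unfolding h by (intro nn_integral_cong) (auto split: split_indicator)
        finally show ?thesis .
      next
        case False
        define ts where "ts = sorted_list_of_set J"
        have ts: "set ts = J" "sorted_wrt (<) ts" "ts \<noteq> []"
          using J by (auto simp: ts_def)
        have last: "last ts = s"
        proof (rule antisym)
          show "last ts \<le> s" using ts J last_in_set[of ts] by auto
          show "s \<le> last ts" using ts J by (auto simp: strict_sorted_iff intro: sorted_le_last)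
        qed
        have tnJ: "t \<notin> J" using False J st by auto
        have tst: "sorted_wrt (<) (ts @ [t])" using ts J False st by (fastforce simp: sorted_wrt_append)
        \<comment> \<open>Since \<open>t\<close> is not among the times of the cylinder, its constraint can be added freely.\<close>
        let ?E = "D(t := A)"
        have "emeasure N (C \<inter> ?V) = (\<integral>\<^sup>+\<omega>\<in>{\<omega> \<in> space N. \<forall>r\<in>set (ts @ [t]). Y r \<omega> \<in> ?E r}. 1 \<partial>N)"
        proof -
          have CV: "C \<inter> ?V = {\<omega> \<in> space N. \<forall>r\<in>set (ts @ [t]). Y r \<omega> \<in> ?E r}"
            using tnJ ts unfolding C_eq by auto
          have "C \<inter> ?V \<in> sets N" using FN[OF CF] by measurable
          then show ?thesis unfolding CV by simp
        qed
        also have "\<dots> = chain_integral ?E (\<lambda>_. 1) (ts @ [t]) 0 a"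
          using tst ts J st A by (intro has_fddD[OF fdd]) auto
        also have "\<dots> = chain_integral ?E (\<lambda>y. emeasure (K s t y) A) ts 0 a"
          unfolding chain_integral_snoc using last ts(3) A st by (simp add: sets_kernel)
        also have "\<dots> = chain_integral D (\<lambda>y. emeasure (K s t y) A) ts 0 a"
          using tnJ ts by (intro chain_integral_cong) auto
        also have "\<dots> = (\<integral>\<^sup>+\<omega>\<in>{\<omega> \<in> space N. \<forall>r\<in>set ts. Y r \<omega> \<in> D r}. ?h \<omega> \<partial>N)"
        proof -
          have D: "set ts \<subseteq> {0..T}" "\<And>r. r \<in> set ts \<Longrightarrow> D r \<in> sets borel"
            using J ts(1) st by auto
          have "(\<lambda>y. emeasure (K s t y) A) \<in> borel_measurable borel" by measurable
          from has_fddD[OF fdd ts(3,2) D this] show ?thesis unfolding last by simp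
        qed
        finally show ?thesis by (simp add: C_eq ts)
      qed
      then show "emeasure (restr_to_subalg (density N (indicator ?V)) ?F) C =
          emeasure (restr_to_subalg (density N ?h) ?F) C"
        using sub1 CF e1 e2 by (simp add: emeasure_restr_to_subalg)
    qed simp
    then have "emeasure (density N (indicator ?V)) B = emeasure (density N ?h) B"
      using emeasure_restr_to_subalg[OF sub1(1) B] emeasure_restr_to_subalg[OF sub1(2) B] by simp
    then show ?thesis using e1[OF B] e2[OF B] by simp
  qed
  then show ?thesis
    using start Y prob_space_axioms unfolding markov_from_def by auto
qed

text \<open>
  The conditional probability depends on the present only, so any family of past times that contains
  the present yields the same one. The cases \<open>I = {0..s}\<close> and \<open>I = {s}\<close> together are the Markov
  property of \<open>markov_process\<close>.
\<close>

lemma markov_from_cond_prob: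
  assumes mk: "markov_from N Y a" and st: "0 \<le> s" "s \<le> t" "t \<le> T"
    and I: "s \<in> I" "I \<subseteq> {0..s}" and A: "A \<in> sets borel"
  shows "AE \<omega> in N. cond_prob_in N (gen_by N Y I) (Y t) A \<omega> = measure (K s t (Y s \<omega>)) A"
proof -
  have N: "prob_space N" and Y: "\<And>u. u \<in> {0..T} \<Longrightarrow> Y u \<in> N \<rightarrow>\<^sub>M borel"
    using mk by (auto simp: markov_from_def)
  have sub: "subalgebra N (gen_by N Y I)"
    using I st by (intro subalgebra_gen_by Y) auto
  have "(\<lambda>\<omega>. measure (K s t (Y s \<omega>)) A) \<in> borel_measurable (gen_by N Y I)"
    using measurable_compose[OF measurable_gen_by[of s I Y N] measurable_compose[OF kernel[OF st] measurable_measure_prob_algebra[OF A]]] I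
    by simp
  moreover have "measure (K s t x) A \<le> 1" for x
    using prob_space.prob_le_1[OF prob_space_kernel[OF st]] .
  moreover have "emeasure N (B \<inter> {\<omega> \<in> space N. Y t \<omega> \<in> A}) =
      (\<integral>\<^sup>+\<omega>\<in>B. ennreal (measure (K s t (Y s \<omega>)) A) \<partial>N)" if "B \<in> sets (gen_by N Y I)" for B
  proof -
    have "B \<in> sets (gen_by N Y {0..s})" using that sets_gen_by_mono[OF I(2)] by auto
    then show ?thesis
      using mk st A unfolding markov_from_def
      by (simp add: finite_measure.emeasure_eq_measure[OF prob_space.finite_measure[OF prob_space_kernel[OF st]]])
  qed
  ultimately show ?thesis
    using cond_prob_in_iff[OF N sub Y[of t] A, of "\<lambda>\<omega>. measure (K s t (Y s \<omega>)) A"] st by simp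
qed

text \<open>
  The product \<open>\<sigma>\<close>-algebra is generated by the cylinders, which are stable under intersection, and both
  measures give a cylinder the same iterated integral. As \<open>N\<close> may itself be a measure on path space
  with its coordinate process, this contains the uniqueness of \<open>P\<close>.
\<close>

lemma path_law_eq:
  assumes N: "has_fdd N Y a"
    and P: "has_fdd P (\<lambda>t \<omega>. \<omega> t) a" "sets P = sets (path_space T)"
  shows "path_law N T Y = P"
proof -
  have Y: "Y t \<in> N \<rightarrow>\<^sub>M borel" if "t \<in> {0..T}" for t
    using N that by (auto simp: has_fdd_def)
  then have m: "(\<lambda>\<omega>. \<lambda>t\<in>{0..T}. Y t \<omega>) \<in> N \<rightarrow>\<^sub>M PiM {0..T} (\<lambda>_. borel)"
    by (intro measurable_restrict) auto
  show ?thesis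
  proof (rule measure_eqI_PiM_infinite[where M = "\<lambda>_. borel"])
    show "sets (path_law N T Y) = sets (PiM {0..T} (\<lambda>_. borel))"
      by (simp add: path_law_def path_space_def)
    show P': "sets P = sets (PiM {0..T} (\<lambda>_. borel))" by (simp add: P path_space_def)
    have "prob_space (path_law N T Y)"
      using N m unfolding path_law_def path_space_def
      by (intro prob_space.prob_space_distr) (auto simp: has_fdd_def)
    then show "finite_measure (path_law N T Y)"
      by (simp add: prob_space.finite_measure)
    fix A :: "real \<Rightarrow> 'e set" and J
    assume J: "finite J" "J \<subseteq> {0..T}" and A: "\<And>t. t \<in> J \<Longrightarrow> A t \<in> sets borel"
    let ?E = "prod_emb {0..T} (\<lambda>_. borel) J (Pi\<^sub>E J A)"
    have E: "?E \<in> sets (PiM {0..T} (\<lambda>_. borel))"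
      using J A by (intro sets_PiM_I) auto
    have r: "restrict (\<lambda>t\<in>{0..T}. Y t \<omega>) J = (\<lambda>t\<in>J. Y t \<omega>)" for \<omega>
      using J by (auto simp: restrict_def fun_eq_iff)
    have "emeasure (path_law N T Y) ?E = emeasure N {\<omega> \<in> space N. \<forall>t\<in>J. Y t \<omega> \<in> A t}"
      unfolding path_law_def path_space_def emeasure_distr[OF m E]
      using J by (intro arg_cong[where f = "emeasure N"]) (auto simp: prod_emb_def r PiE_iff simp del: restrict_restrict)
    also have "\<dots> = emeasure P {\<omega> \<in> space P. \<forall>t\<in>J. \<omega> t \<in> A t}"
      using has_fdd_emeasure_cylinder[OF N J A] has_fdd_emeasure_cylinder[OF P(1) J A] by simp
    also have "{\<omega> \<in> space P. \<forall>t\<in>J. \<omega> t \<in> A t} = ?E"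
      using J sets_eq_imp_space_eq[OF P'] by (auto simp: prod_emb_def space_PiM PiE_iff extensional_def)
    finally show "emeasure (path_law N T Y) ?E = emeasure P ?E" .
  qed
qed

section \<open>Existence by Kolmogorov extension\<close>

text \<open>
  The joint law of a chain that starts in \<open>x\<close> at time \<open>s\<close> and moves along the given times. It
  lives on functions on all of \<open>\<real>\<close>, so that no index set has to change during the recursion; the
  coordinates outside the list hold irrelevant values. The constant path in the base case gives the
  coordinate \<open>s\<close> itself the value \<open>x\<close>, which is needed when the list is empty. The state at time \<open>t\<close> is
  written after the rest of the path has been drawn, so it cannot be overwritten later.
\<close>

primrec walk :: "real list \<Rightarrow> real \<Rightarrow> 'e \<Rightarrow> (real \<Rightarrow> 'e) measure" where
  "walk [] s x = return (PiM UNIV (\<lambda>_. borel)) (\<lambda>_. x)"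
| "walk (t # ts) s x =
     K s t x \<bind> (\<lambda>y. distr (walk ts t y) (PiM UNIV (\<lambda>_. borel)) (\<lambda>\<omega>. fun_upd \<omega> t y))"

lemma measurable_update [measurable]:
  "(\<lambda>(y, \<omega>). fun_upd \<omega> t y) \<in> borel \<Otimes>\<^sub>M PiM UNIV (\<lambda>_. borel) \<rightarrow>\<^sub>M PiM UNIV (\<lambda>_::real. borel::'e measure)"
proof (rule measurable_PiM_single')
  fix i :: real
  show "(\<lambda>\<omega>. (case \<omega> of (y, \<omega>) \<Rightarrow> fun_upd \<omega> t y) i)
      \<in> borel \<Otimes>\<^sub>M PiM UNIV (\<lambda>_. borel::'e measure) \<rightarrow>\<^sub>M borel"
    by (cases "i = t") (auto simp: case_prod_beta')
qed (auto simp: space_PiM)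

lemma kernel_walk:
  assumes "sorted (s # ts)" "set (s # ts) \<subseteq> {0..T}"
  shows "walk ts s \<in> borel \<rightarrow>\<^sub>M prob_algebra (PiM UNIV (\<lambda>_. borel))"
  using assms
proof (induction ts arbitrary: s)
  case Nil
  have "(\<lambda>x. \<lambda>_::real. x) \<in> borel \<rightarrow>\<^sub>M PiM UNIV (\<lambda>_. borel::'e measure)"
    by (rule measurable_PiM_single') (auto simp: space_PiM)
  from measurable_compose[OF this measurable_return_prob_space] show ?case by simp
next
  case (Cons t ts)
  then have [measurable]: "walk ts t \<in> borel \<rightarrow>\<^sub>M prob_algebra (PiM UNIV (\<lambda>_. borel))"
    and [measurable]: "K s t \<in> borel \<rightarrow>\<^sub>M prob_algebra borel"
    using kernel by auto
  have "(\<lambda>y. distr (walk ts t y) (PiM UNIV (\<lambda>_. borel)) (\<lambda>\<omega>. fun_upd \<omega> t y))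
      \<in> borel \<rightarrow>\<^sub>M prob_algebra (PiM UNIV (\<lambda>_. borel))"
    by (rule measurable_distr_prob_space2[where M = "PiM UNIV (\<lambda>_. borel)"]) measurable
  then show ?case by (simp add: measurable_bind_prob_space)
qed

lemma sets_walk:
  assumes "sorted (s # ts)" "set (s # ts) \<subseteq> {0..T}"
  shows "sets (walk ts s x) = sets (PiM UNIV (\<lambda>_. borel))"
  using measurable_space[OF kernel_walk[OF assms], of x] by (simp add: space_prob_algebra)

lemma prob_space_walk:
  assumes "sorted (s # ts)" "set (s # ts) \<subseteq> {0..T}"
  shows "prob_space (walk ts s x)"
  using measurable_space[OF kernel_walk[OF assms], of x] by (simp add: space_prob_algebra)

text \<open>
  The update at the first time \<open>t\<close> leaves the coordinates at the later times alone because the times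
  are distinct, so the integral over the rest of the path is the one of the induction hypothesis.
\<close>

lemma nn_integral_walk:
  assumes "sorted (s # ts)" "set (s # ts) \<subseteq> {0..T}" "distinct ts"
    and "\<And>t. t \<in> set ts \<Longrightarrow> A t \<in> sets borel" "g \<in> borel_measurable borel"
  shows "(\<integral>\<^sup>+\<omega>. indicator {\<omega>. \<forall>t\<in>set ts. \<omega> t \<in> A t} \<omega> * g (\<omega> (last (s # ts))) \<partial>walk ts s x) =
    chain_integral A g ts s x"
  using assms
proof (induction ts arbitrary: s x)
  case Nil
  have [measurable]: "g \<in> borel_measurable borel" by fact
  show ?case by (simp add: nn_integral_return space_PiM)
next
  case (Cons t ts)
  let ?S = "PiM UNIV (\<lambda>_::real. borel :: 'e measure)"
  have [measurable]: "g \<in> borel_measurable borel" by fact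
  have st: "0 \<le> s" "s \<le> t" "t \<le> T" using Cons.prems by auto
  have w: "sorted (t # ts)" "set (t # ts) \<subseteq> {0..T}" using Cons.prems by auto
  have cyl[measurable]: "{\<omega>. \<forall>r\<in>set us. \<omega> r \<in> A r} \<in> sets ?S"
    if "set us \<subseteq> set (t # ts)" for us
    using measurable_cylinder[of "set us" "\<lambda>t \<omega>. \<omega> t" ?S A] Cons.prems(4) that
    by (auto simp: space_PiM)
  let ?h = "\<lambda>\<omega>. indicator {\<omega>. \<forall>r\<in>set (t # ts). \<omega> r \<in> A r} \<omega> * g (\<omega> (last (t # ts)))"
  have h[measurable]: "?h \<in> borel_measurable ?S"
    by (intro borel_measurable_times_ennreal borel_measurable_indicator cyl) auto
  have [measurable]: "walk ts t \<in> borel \<rightarrow>\<^sub>M prob_algebra ?S" by (rule kernel_walk[OF w])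
  have d: "(\<lambda>y. distr (walk ts t y) ?S (\<lambda>\<omega>. fun_upd \<omega> t y)) \<in> borel \<rightarrow>\<^sub>M subprob_algebra ?S"
    by (intro measurable_prob_algebraD measurable_distr_prob_space2[where M = ?S]) measurable
  have "(\<integral>\<^sup>+\<omega>. ?h \<omega> \<partial>walk (t # ts) s x) =
      (\<integral>\<^sup>+y. \<integral>\<^sup>+\<omega>. ?h \<omega> \<partial>distr (walk ts t y) ?S (\<lambda>\<omega>. fun_upd \<omega> t y) \<partial>K s t x)"
    unfolding walk.simps
    by (rule nn_integral_bind[OF h])
       (simp only: measurable_cong_sets[OF sets_kernel[OF st] refl] d)
  also have "\<dots> = (\<integral>\<^sup>+y. \<integral>\<^sup>+\<omega>. ?h (fun_upd \<omega> t y) \<partial>walk ts t y \<partial>K s t x)"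
  proof (intro nn_integral_cong nn_integral_distr)
    fix y
    show "(\<lambda>\<omega>. fun_upd \<omega> t y) \<in> walk ts t y \<rightarrow>\<^sub>M ?S"
      using measurable_compose[OF measurable_Pair1'[of y borel ?S] measurable_update[of t]]
      by (simp add: measurable_cong_sets[OF sets_walk[OF w] refl])
  qed (simp only: measurable_distr_eq1 h)
  also have "\<dots> = (\<integral>\<^sup>+y. indicator (A t) y * chain_integral A g ts t y \<partial>K s t x)"
  proof (intro nn_integral_cong)
    fix y
    let ?k = "\<lambda>\<omega>. indicator {\<omega>. \<forall>r\<in>set ts. \<omega> r \<in> A r} \<omega> * g (\<omega> (last (t # ts)))"
    have k[measurable]: "?k \<in> borel_measurable ?S"
      by (intro borel_measurable_times_ennreal borel_measurable_indicator cyl) auto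
    have "(\<integral>\<^sup>+\<omega>. ?h (fun_upd \<omega> t y) \<partial>walk ts t y) = (\<integral>\<^sup>+\<omega>. indicator (A t) y * ?k \<omega> \<partial>walk ts t y)"
    \<comment> \<open>If no times are left, the last time is \<open>t\<close>, and the coordinate that the update overwrites is read;
      it already has the value \<open>y\<close>, since the path is constant.\<close>
    proof (cases "ts = []")
      case True
      have m: "(\<lambda>\<omega>. ?h (fun_upd \<omega> t y)) \<in> borel_measurable ?S"
        using measurable_compose[OF measurable_Pair1'[of y borel ?S] measurable_compose[OF measurable_update[of t] h]]
        by simp
      have "(\<integral>\<^sup>+\<omega>. ?h (fun_upd \<omega> t y) \<partial>return ?S (\<lambda>_. y)) = ?h (fun_upd (\<lambda>_. y) t y)"
        by (rule nn_integral_return[OF _ m]) (simp add: space_PiM)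
      moreover have "(\<integral>\<^sup>+\<omega>. indicator (A t) y * ?k \<omega> \<partial>return ?S (\<lambda>_. y)) = indicator (A t) y * ?k (\<lambda>_. y)"
        by (rule nn_integral_return[OF _ borel_measurable_times_ennreal[OF _ k]]) (simp_all add: space_PiM)
      ultimately show ?thesis using True by (simp add: indicator_def)
    next
      case False
      then have last: "last ts \<noteq> t" using Cons.prems(3) last_in_set by fastforce
      have "?h (fun_upd \<omega> t y) = indicator (A t) y * ?k \<omega>" for \<omega>
      proof -
        have "(\<forall>r\<in>set ts. fun_upd \<omega> t y r \<in> A r) \<longleftrightarrow> (\<forall>r\<in>set ts. \<omega> r \<in> A r)"
          using Cons.prems(3) by auto
        then show ?thesis using False last by (simp add: indicator_def)
      qed
      then show ?thesis by simp
    qed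
    also have "\<dots> = indicator (A t) y * (\<integral>\<^sup>+\<omega>. ?k \<omega> \<partial>walk ts t y)"
      by (rule nn_integral_cmult) (simp only: measurable_cong_sets[OF sets_walk[OF w] refl] k)
    also have "(\<integral>\<^sup>+\<omega>. ?k \<omega> \<partial>walk ts t y) = chain_integral A g ts t y"
      using Cons.prems by (intro Cons.IH) auto
    finally show "(\<integral>\<^sup>+\<omega>. ?h (fun_upd \<omega> t y) \<partial>walk ts t y) = indicator (A t) y * chain_integral A g ts t y" .
  qed
  finally show ?case by simp
qed

lemma admissible_times:
  assumes "finite J" "J \<subseteq> {0..T}"
  shows "sorted (0 # sorted_list_of_set J)" "set (0 # sorted_list_of_set J) \<subseteq> {0..T}"
    "distinct (sorted_list_of_set J)"
  using assms T_nonneg by auto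

text \<open>
  The consistency condition of Kolmogorov's theorem: prescribing nothing at the times in
  \<open>J - H\<close> leaves the distribution at the times in \<open>H\<close>. Both lists reduce to the list of
  effectively constrained times.
\<close>

lemma chain_integral_eq_superset:
  assumes J: "finite J" "J \<subseteq> {0..T}" and H: "H \<subseteq> J"
    and A: "\<And>t. t \<in> H \<Longrightarrow> A t \<in> sets borel"
  shows "chain_integral (\<lambda>t. if t \<in> H then A t else UNIV) (\<lambda>_. 1) (sorted_list_of_set J) 0 a =
    chain_integral A (\<lambda>_. 1) (sorted_list_of_set H) 0 a"
proof -
  let ?A = "\<lambda>t. if t \<in> H then A t else UNIV"
  have H': "finite H" "H \<subseteq> {0..T}" using J H finite_subset by auto
  have drop: "chain_integral ?A (\<lambda>_. 1) (sorted_list_of_set L) 0 a =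
      chain_integral ?A (\<lambda>_. 1) (sorted_list_of_set {t \<in> H. A t \<noteq> UNIV}) 0 a"
    if L: "finite L" "L \<subseteq> {0..T}" "H \<subseteq> L" for L
  proof -
    have "filter (\<lambda>t. ?A t \<noteq> UNIV) (sorted_list_of_set L) = sorted_list_of_set {t \<in> H. A t \<noteq> UNIV}"
      using L H' by (intro sorted_distinct_set_unique sorted_wrt_filter) auto
    then show ?thesis
      using chain_integral_drop_UNIV[OF admissible_times(1,2)[OF L(1,2)], of ?A a] A by simp
  qed
  have "chain_integral ?A (\<lambda>_. 1) (sorted_list_of_set J) 0 a =
      chain_integral ?A (\<lambda>_. 1) (sorted_list_of_set H) 0 a"
    using drop[OF J H] drop[OF H'] by simp
  also have "\<dots> = chain_integral A (\<lambda>_. 1) (sorted_list_of_set H) 0 a"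
    using H' by (intro chain_integral_cong) simp
  finally show ?thesis .
qed

lemma emeasure_walk_cylinder:
  assumes J: "finite J" "J \<subseteq> {0..T}" and H: "H \<subseteq> J"
    and A: "\<And>t. t \<in> H \<Longrightarrow> A t \<in> sets borel"
  shows "emeasure (walk (sorted_list_of_set J) 0 a) {\<omega>. \<forall>t\<in>H. \<omega> t \<in> A t} =
    chain_integral A (\<lambda>_. 1) (sorted_list_of_set H) 0 a"
proof -
  let ?W = "walk (sorted_list_of_set J) 0 a" and ?A = "\<lambda>t. if t \<in> H then A t else UNIV"
  note adm = admissible_times[OF J]
  have eq: "{\<omega>. \<forall>t\<in>H. \<omega> t \<in> A t} = {\<omega>. \<forall>t\<in>set (sorted_list_of_set J). \<omega> t \<in> ?A t}"
    using J H by auto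
  have "{\<omega> \<in> space ?W. \<forall>t\<in>H. \<omega> t \<in> A t} \<in> sets ?W"
    using J H A finite_subset
    by (intro measurable_cylinder) (auto simp: measurable_cong_sets[OF sets_walk[OF adm(1,2)] refl])
  moreover have "space ?W = UNIV"
    using sets_eq_imp_space_eq[OF sets_walk[OF adm(1,2)]] by (simp add: space_PiM)
  ultimately have "emeasure ?W {\<omega>. \<forall>t\<in>H. \<omega> t \<in> A t} =
      (\<integral>\<^sup>+\<omega>. indicator {\<omega>. \<forall>t\<in>H. \<omega> t \<in> A t} \<omega> * 1 \<partial>?W)"
    by simp
  also have "\<dots> =
      (\<integral>\<^sup>+\<omega>. indicator {\<omega>. \<forall>t\<in>set (sorted_list_of_set J). \<omega> t \<in> ?A t} \<omega> * 1 \<partial>?W)"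
    unfolding eq ..
  also have "\<dots> = chain_integral ?A (\<lambda>_. 1) (sorted_list_of_set J) 0 a"
    using nn_integral_walk[OF adm, of ?A "\<lambda>_. 1" a] A by simp
  finally show ?thesis using chain_integral_eq_superset[OF J H A] by simp
qed

definition marginal :: "'e \<Rightarrow> real set \<Rightarrow> (real \<Rightarrow> 'e) measure" where
  "marginal a J = distr (walk (sorted_list_of_set J) 0 a) (PiM J (\<lambda>_. borel)) (\<lambda>\<omega>. restrict \<omega> J)"

lemma measurable_restrict_walk:
  assumes "finite J" "J \<subseteq> {0..T}"
  shows "(\<lambda>\<omega>. restrict \<omega> H) \<in> walk (sorted_list_of_set J) 0 a \<rightarrow>\<^sub>M PiM H (\<lambda>_. borel)"
  by (subst measurable_cong_sets[OF sets_walk[OF admissible_times(1,2)[OF assms]] refl])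
     (rule measurable_restrict_subset, simp)

lemma prob_space_marginal:
  assumes J: "finite J" "J \<subseteq> {0..T}"
  shows "prob_space (marginal a J)"
  unfolding marginal_def
  by (intro prob_space.prob_space_distr prob_space_walk admissible_times measurable_restrict_walk J)

lemma projective_family_marginal: "projective_family {0..T} (marginal a) (\<lambda>_. borel)"
proof (rule projective_family.intro)
  fix J :: "real set" assume J: "finite J" "J \<subseteq> {0..T}"
  then show "prob_space (marginal a J)" by (rule prob_space_marginal)
next
  fix H J :: "real set" assume HJ: "H \<subseteq> J" "finite J" "J \<subseteq> {0..T}"
  then have H: "finite H" "H \<subseteq> {0..T}" using finite_subset by auto
  let ?R = "distr (marginal a J) (PiM H (\<lambda>_. borel)) (\<lambda>\<omega>. restrict \<omega> H)"
  have R: "?R = distr (walk (sorted_list_of_set J) 0 a) (PiM H (\<lambda>_. borel)) (\<lambda>\<omega>. restrict \<omega> H)"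
    unfolding marginal_def
    using HJ by (subst distr_distr)
       (auto simp: comp_def Int_absorb1 intro!: measurable_restrict_walk measurable_restrict_subset distr_cong)
  have em: "emeasure (distr (walk (sorted_list_of_set L) 0 a) (PiM H (\<lambda>_. borel)) (\<lambda>\<omega>. restrict \<omega> H)) (Pi\<^sub>E H A) =
      chain_integral A (\<lambda>_. 1) (sorted_list_of_set H) 0 a"
    if L: "finite L" "L \<subseteq> {0..T}" "H \<subseteq> L" and A: "\<And>t. t \<in> H \<Longrightarrow> A t \<in> sets borel" for L A
  proof -
    have "space (walk (sorted_list_of_set L) 0 a) = UNIV"
      using sets_eq_imp_space_eq[OF sets_walk[OF admissible_times(1,2)[OF L(1,2)]]] by (simp add: space_PiM)
    moreover have "(\<lambda>\<omega>. restrict \<omega> H) -` (Pi\<^sub>E H A) = {\<omega>. \<forall>t\<in>H. \<omega> t \<in> A t}"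
      by (auto simp: PiE_iff)
    ultimately show ?thesis
      using H A emeasure_walk_cylinder[OF L A]
      by (simp add: emeasure_distr[OF measurable_restrict_walk[OF L(1,2)]])
  qed
  show "marginal a H = ?R"
    unfolding R
  proof (rule measure_eqI_PiM_finite[OF H(1)])
    show "range (\<lambda>_::nat. space (PiM H (\<lambda>_. borel::'e measure))) \<subseteq> prod_algebra H (\<lambda>_. borel)"
      using H by (auto simp: space_PiM intro!: prod_algebraI_finite)
    show "emeasure (marginal a H) (space (PiM H (\<lambda>_. borel::'e measure))) \<noteq> \<infinity>"
      using finite_measure.emeasure_finite[OF prob_space.finite_measure[OF prob_space_marginal[OF H]]]
      by simp
    fix A assume "\<And>t. t \<in> H \<Longrightarrow> A t \<in> sets (borel :: 'e measure)"
    then show "emeasure (marginal a H) (Pi\<^sub>E H A) =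
      emeasure (distr (walk (sorted_list_of_set J) 0 a) (PiM H (\<lambda>_. borel)) (\<lambda>\<omega>. restrict \<omega> H)) (Pi\<^sub>E H A)"
      using em[of H A] em[of J A] H HJ by (simp add: marginal_def)
  qed (auto simp: marginal_def)
qed

text \<open>
  The projective limit of the marginals. The test function in \<open>has_fdd\<close> depends on finitely many
  coordinates only, so its integral can be computed under a marginal and hence along \<open>walk\<close>.
\<close>

lemma ex_measure_has_fdd:
  "\<exists>P. prob_space P \<and> sets P = sets (path_space T) \<and> has_fdd P (\<lambda>t \<omega>. \<omega> t) a"
proof -
  interpret polish_projective "{0..T}" "marginal a"
    unfolding polish_projective_def by (rule projective_family_marginal)
  have meas [measurable]: "(\<lambda>\<omega>. \<omega> t) \<in> lim \<rightarrow>\<^sub>M (borel :: 'e measure)" if "t \<in> {0..T}" for t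
    using measurable_component_singleton[OF that, of "\<lambda>_. borel"]
    by (simp add: measurable_cong_sets[OF sets_lim refl])
  have marg: "distr lim (PiM J (\<lambda>_. borel)) (\<lambda>\<omega>. restrict \<omega> J) = marginal a J"
    if J: "finite J" "J \<subseteq> {0..T}" for J
  proof (rule measure_eqI)
    fix A assume "A \<in> sets (distr lim (PiM J (\<lambda>_. borel)) (\<lambda>\<omega>. restrict \<omega> J))"
    then have "A \<in> sets (PiM J (\<lambda>_. borel))" by simp
    then show "emeasure (distr lim (PiM J (\<lambda>_. borel)) (\<lambda>\<omega>. restrict \<omega> J)) A = emeasure (marginal a J) A"
      using J by (subst emeasure_distr_restrict[OF J(2)]) (auto simp: emeasure_lim_emb)
  qed (simp add: marginal_def)
  have "(\<integral>\<^sup>+\<omega>\<in>{\<omega> \<in> space lim. \<forall>t\<in>set ts. \<omega> t \<in> A t}. g (\<omega> (last ts)) \<partial>lim) = chain_integral A g ts 0 a"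
    if ts: "ts \<noteq> []" "sorted_wrt (<) ts" "set ts \<subseteq> {0..T}" and A: "\<forall>t\<in>set ts. A t \<in> sets borel"
      and g [measurable]: "g \<in> borel_measurable borel" for ts A g
  proof -
    let ?J = "set ts"
    let ?P = "PiM ?J (\<lambda>_. borel :: 'e measure)"
    let ?f = "\<lambda>\<omega>. indicator {\<omega> \<in> space ?P. \<forall>t\<in>?J. \<omega> t \<in> A t} \<omega> * g (\<omega> (last ts))"
    have J: "sorted_list_of_set ?J = ts"
      using ts by (simp add: strict_sorted_iff sorted_list_of_set.idem_if_sorted_distinct)
    have last: "last ts \<in> ?J" using ts by simp
    have [measurable]: "{\<omega> \<in> space ?P. \<forall>t\<in>?J. \<omega> t \<in> A t} \<in> sets ?P"
      using A by (intro measurable_cylinder) auto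
    have f: "?f \<in> borel_measurable ?P"
      using last by (intro borel_measurable_times_ennreal borel_measurable_indicator) auto
    note adm = admissible_times[OF _ ts(3), unfolded J, simplified]
    have "(\<integral>\<^sup>+\<omega>\<in>{\<omega> \<in> space lim. \<forall>t\<in>set ts. \<omega> t \<in> A t}. g (\<omega> (last ts)) \<partial>lim) =
        (\<integral>\<^sup>+\<omega>. ?f (restrict \<omega> ?J) \<partial>lim)"
      using last by (intro nn_integral_cong) (auto simp: space_PiM PiE_iff split: split_indicator)
    also have "\<dots> = (\<integral>\<^sup>+\<omega>. ?f \<omega> \<partial>distr lim ?P (\<lambda>\<omega>. restrict \<omega> ?J))"
    proof (intro nn_integral_distr[symmetric])
      show "(\<lambda>\<omega>. restrict \<omega> ?J) \<in> lim \<rightarrow>\<^sub>M ?P"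
        unfolding measurable_cong_sets[OF sets_lim refl] by (rule measurable_restrict_subset[OF ts(3)])
    qed (use f in simp)
    also have "\<dots> = (\<integral>\<^sup>+\<omega>. ?f \<omega> \<partial>distr (walk ts 0 a) ?P (\<lambda>\<omega>. restrict \<omega> ?J))"
      using marg[of ?J] ts by (simp add: marginal_def J)
    also have "\<dots> = (\<integral>\<^sup>+\<omega>. ?f (restrict \<omega> ?J) \<partial>walk ts 0 a)"
      using measurable_restrict_walk[of ?J ?J a] ts f by (intro nn_integral_distr) (simp_all add: J)
    also have "\<dots> = (\<integral>\<^sup>+\<omega>. indicator {\<omega>. \<forall>t\<in>set ts. \<omega> t \<in> A t} \<omega> * g (\<omega> (last (0 # ts))) \<partial>walk ts 0 a)"
      using last ts(1) by (intro nn_integral_cong) (auto simp: space_PiM PiE_iff split: split_indicator)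
    also have "\<dots> = chain_integral A g ts 0 a"
      using A ts admissible_times[OF _ ts(3)] by (intro nn_integral_walk) (auto simp: J)
    finally show ?thesis .
  qed
  then have "has_fdd lim (\<lambda>t \<omega>. \<omega> t) a"
    unfolding has_fdd_def using P.prob_space_axioms meas by blast
  then show ?thesis
    using P.prob_space_axioms by (intro exI[of _ lim]) (auto simp: path_space_def)
qed

end

section \<open>Kernels pinned at the end point\<close>

text \<open>
  The clause \<open>s = t\<close> comes first, so that at \<open>s = t = T\<close> the kernel is the identity. The opposite
  order would make it move every state to \<open>b\<close>.
\<close>

definition pinned_kernel ::
    "'e::polish_space measure \<Rightarrow> (real \<Rightarrow> real \<Rightarrow> 'e \<Rightarrow> 'e \<Rightarrow> real) \<Rightarrow> real \<Rightarrow> 'e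
      \<Rightarrow> real \<Rightarrow> real \<Rightarrow> 'e \<Rightarrow> 'e measure" where
  "pinned_kernel \<mu> p T b s t x =
     (if s = t then return borel x
      else if t < T then density \<mu> (\<lambda>y. ennreal (p s t x y))
      else return borel b)"

locale pinned_densities = sigma_finite_measure \<mu> for \<mu> :: "'e::polish_space measure" +
  fixes p :: "real \<Rightarrow> real \<Rightarrow> 'e \<Rightarrow> 'e \<Rightarrow> real" and T :: real and b :: 'e
  assumes T_pos: "0 < T"
    and sets_base: "sets \<mu> = sets borel"
    and p_measurable: "\<And>s t. 0 \<le> s \<Longrightarrow> s < t \<Longrightarrow> t < T \<Longrightarrow>
      (\<lambda>(x, y). p s t x y) \<in> borel_measurable (borel \<Otimes>\<^sub>M borel)"
    and p_nonneg: "\<And>s t x y. 0 \<le> s \<Longrightarrow> s < t \<Longrightarrow> t < T \<Longrightarrow> 0 \<le> p s t x y"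
    and p_total: "\<And>s t x. 0 \<le> s \<Longrightarrow> s < t \<Longrightarrow> t < T \<Longrightarrow>
      (\<integral>\<^sup>+ y. ennreal (p s t x y) \<partial>\<mu>) = 1"
    and p_chapman_kolmogorov: "\<And>s t u x z. 0 \<le> s \<Longrightarrow> s < t \<Longrightarrow> t < u \<Longrightarrow> u < T \<Longrightarrow>
      ennreal (p s u x z) = (\<integral>\<^sup>+ y. ennreal (p s t x y * p t u y z) \<partial>\<mu>)"
begin

abbreviation Kp :: "real \<Rightarrow> real \<Rightarrow> 'e \<Rightarrow> 'e measure" where
  "Kp \<equiv> pinned_kernel \<mu> p T b"

lemma space_base: "space \<mu> = UNIV"
  using sets_eq_imp_space_eq[OF sets_base] by simp

lemma measurable_base: "borel_measurable \<mu> = borel_measurable borel"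
  by (rule measurable_cong_sets[OF sets_base refl])

lemma p_measurable_base:
  assumes "0 \<le> s" "s < t" "t < T"
  shows "(\<lambda>(x, y). ennreal (p s t x y)) \<in> borel_measurable (borel \<Otimes>\<^sub>M \<mu>)"
proof -
  have "(\<lambda>(x, y). ennreal (p s t x y)) \<in> borel_measurable (borel \<Otimes>\<^sub>M borel)"
    using p_measurable[OF assms] by (simp add: case_prod_beta')
  then show ?thesis
    by (simp add: measurable_cong_sets[OF sets_pair_measure_cong[OF refl sets_base] refl])
qed

lemma density_kernel_measurable:
  assumes st: "0 \<le> s" "s < t" "t < T"
  shows "(\<lambda>x. density \<mu> (\<lambda>y. ennreal (p s t x y))) \<in> borel \<rightarrow>\<^sub>M prob_algebra borel"
proof (rule measurable_prob_algebraI)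
  note [measurable] = p_measurable_base[OF st]
  have prob: "prob_space (density \<mu> (\<lambda>y. ennreal (p s t x y)))" for x
    using p_total[OF st] by (intro prob_spaceI) (simp add: emeasure_density cong: nn_integral_cong)
  then show "prob_space (density \<mu> (\<lambda>y. ennreal (p s t x y)))" for x .
  show "(\<lambda>x. density \<mu> (\<lambda>y. ennreal (p s t x y))) \<in> borel \<rightarrow>\<^sub>M subprob_algebra borel"
  proof (rule measurable_subprob_algebra)
    fix A :: "'e set" assume "A \<in> sets borel"
    then have [measurable]: "A \<in> sets \<mu>" by (simp add: sets_base)
    show "(\<lambda>x. emeasure (density \<mu> (\<lambda>y. ennreal (p s t x y))) A) \<in> borel_measurable borel"
      by (simp add: emeasure_density) measurable
  qed (auto simp: sets_base intro!: prob_space_imp_subprob_space prob)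
qed

lemma pinned_kernel_measurable:
  assumes "0 \<le> s" "s \<le> t" "t \<le> T"
  shows "Kp s t \<in> borel \<rightarrow>\<^sub>M prob_algebra borel"
proof -
  consider "s = t" | "s < t" "t < T" | "s < t" "t = T" using assms by linarith
  then show ?thesis
  proof cases
    case 1
    then show ?thesis by (simp add: pinned_kernel_def[abs_def])
  next
    case 2
    then show ?thesis using density_kernel_measurable[of s t] assms
      by (simp add: pinned_kernel_def[abs_def])
  next
    case 3
    then show ?thesis
      by (simp add: pinned_kernel_def[abs_def] space_prob_algebra prob_space_return)
  qed
qed

text \<open>
  Exchanging the order of integration puts the intermediate state \<open>y\<close> inside, where the
  Chapman-Kolmogorov equation of the densities evaluates its integral for every fixed end state
  \<open>z\<close>.
\<close>

lemma density_bind_density: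
  assumes stu: "0 \<le> s" "s < t" "t < u" "u < T"
  shows "density \<mu> (\<lambda>y. ennreal (p s t x y)) \<bind> (\<lambda>y. density \<mu> (\<lambda>z. ennreal (p t u y z))) =
    density \<mu> (\<lambda>z. ennreal (p s u x z))" (is "_ = ?F")
proof (rule measure_eqI)
  let ?D = "density \<mu> (\<lambda>y. ennreal (p s t x y))"
  let ?E = "\<lambda>y. density \<mu> (\<lambda>z. ennreal (p t u y z))"
  have st: "0 \<le> s" "s < t" "t < T" and tu: "0 \<le> t" "t < u" "u < T" and su: "0 \<le> s" "s < u" "u < T"
    using stu by auto
  have E: "?E \<in> borel \<rightarrow>\<^sub>M subprob_algebra borel"
    by (rule measurable_prob_algebraD[OF density_kernel_measurable[OF tu]])
  show "sets (?D \<bind> ?E) = sets ?F"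
    by (subst sets_bind[where N = borel]) (auto simp: sets_base space_base)
  fix A assume "A \<in> sets (?D \<bind> ?E)"
  then have "A \<in> sets borel"
    by (subst (asm) sets_bind[where N = borel]) (auto simp: sets_base space_base)
  then have [measurable]: "A \<in> sets \<mu>" by (simp add: sets_base)
  have [measurable]: "(\<lambda>(x, y). ennreal (p s t x y)) \<in> borel_measurable (\<mu> \<Otimes>\<^sub>M \<mu>)"
    "(\<lambda>(x, y). ennreal (p t u x y)) \<in> borel_measurable (\<mu> \<Otimes>\<^sub>M \<mu>)"
    "(\<lambda>(x, y). ennreal (p s u x y)) \<in> borel_measurable (\<mu> \<Otimes>\<^sub>M \<mu>)"
    using p_measurable_base[OF st] p_measurable_base[OF tu] p_measurable_base[OF su]
    by (simp_all add: measurable_cong_sets[OF sets_pair_measure_cong[OF sets_base refl] refl])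
  have x: "x \<in> space \<mu>" using space_base by simp
  interpret pair_sigma_finite \<mu> \<mu> ..
  have "emeasure (?D \<bind> ?E) A = (\<integral>\<^sup>+y. emeasure (?E y) A \<partial>?D)"
    using E \<open>A \<in> sets borel\<close>
    by (intro emeasure_bind[where N = borel]) (auto simp: space_base measurable_base measurable_cong_sets[OF trans[OF sets_density sets_base] refl])
  also have "\<dots> = (\<integral>\<^sup>+y. ennreal (p s t x y) * emeasure (?E y) A \<partial>\<mu>)"
  proof (rule nn_integral_density)
    show "(\<lambda>y. ennreal (p s t x y)) \<in> borel_measurable \<mu>"
      using x by measurable
    show "(\<lambda>y. emeasure (?E y) A) \<in> borel_measurable \<mu>"
      unfolding measurable_base by (rule measurable_emeasure_kernel[OF E \<open>A \<in> sets borel\<close>])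
  qed
  also have "\<dots> = (\<integral>\<^sup>+y. ennreal (p s t x y) * (\<integral>\<^sup>+z. ennreal (p t u y z) * indicator A z \<partial>\<mu>) \<partial>\<mu>)"
    using x by (intro nn_integral_cong arg_cong2[where f = times] refl emeasure_density) measurable
  also have "\<dots> = (\<integral>\<^sup>+y. \<integral>\<^sup>+z. ennreal (p s t x y) * (ennreal (p t u y z) * indicator A z) \<partial>\<mu> \<partial>\<mu>)"
    using x by (intro nn_integral_cong nn_integral_cmult[symmetric]) measurable
  also have "\<dots> = (\<integral>\<^sup>+z. \<integral>\<^sup>+y. ennreal (p s t x y) * (ennreal (p t u y z) * indicator A z) \<partial>\<mu> \<partial>\<mu>)"
    using x by (intro Fubini') measurable
  also have "\<dots> = (\<integral>\<^sup>+z. ennreal (p s u x z) * indicator A z \<partial>\<mu>)"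
  proof (rule nn_integral_cong)
    fix z assume z: "z \<in> space \<mu>"
    have "(\<integral>\<^sup>+y. ennreal (p s t x y) * (ennreal (p t u y z) * indicator A z) \<partial>\<mu>) =
        (\<integral>\<^sup>+y. ennreal (p s t x y * p t u y z) * indicator A z \<partial>\<mu>)"
      using p_nonneg[OF st] p_nonneg[OF tu] by (simp add: ennreal_mult mult.assoc)
    also have "\<dots> = (\<integral>\<^sup>+y. ennreal (p s t x y * p t u y z) \<partial>\<mu>) * indicator A z"
      using p_nonneg[OF st] p_nonneg[OF tu] x z
      by (intro nn_integral_multc) (simp add: ennreal_mult)
    finally show "(\<integral>\<^sup>+y. ennreal (p s t x y) * (ennreal (p t u y z) * indicator A z) \<partial>\<mu>) =
        ennreal (p s u x z) * indicator A z"
      using p_chapman_kolmogorov[OF stu] by simp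
  qed
  also have "\<dots> = emeasure ?F A"
    using x by (simp add: emeasure_density)
  finally show "emeasure (?D \<bind> ?E) A = emeasure ?F A" .
qed

text \<open>
  Only the case \<open>s < t < u < T\<close> needs the Chapman-Kolmogorov equation of the densities. If two of the times agree, one factor is the
  identity kernel; if \<open>u = T\<close>, the second factor is the constant kernel \<open>\<delta>\<^sub>b\<close>.
\<close>

sublocale markov_kernels T Kp
proof
  show "0 \<le> T" using T_pos by simp
  show "Kp s t \<in> borel \<rightarrow>\<^sub>M prob_algebra borel" if "0 \<le> s" "s \<le> t" "t \<le> T" for s t
    by (rule pinned_kernel_measurable[OF that])
  show "Kp s s x = return borel x" for s x by (simp add: pinned_kernel_def)
  fix s t u x assume stu: "0 \<le> s" "s \<le> t" "t \<le> u" "u \<le> T"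
  have st: "Kp s t x \<in> space (prob_algebra borel)"
    using measurable_space[OF pinned_kernel_measurable, of s t x] stu by simp
  have tu: "Kp t u \<in> borel \<rightarrow>\<^sub>M subprob_algebra borel"
    using stu by (intro measurable_prob_algebraD pinned_kernel_measurable) auto
  consider "s = t" | "t = u" | "s < t" "t < u" "u < T" | "s < t" "t < u" "u = T"
    using stu by linarith
  then show "Kp s t x \<bind> Kp t u = Kp s u x"
  proof cases
    case 1
    then have "Kp s t x = return borel x" by (simp add: pinned_kernel_def)
    then show ?thesis using bind_return[OF tu, of x] 1 by simp
  next
    case 2
    then have "Kp t u = return borel" by (simp add: pinned_kernel_def[abs_def])
    then show ?thesis using bind_return''[of "Kp s t x" borel] st 2 by (simp add: space_prob_algebra)
  next
    case 3
    then show ?thesis using density_bind_density[of s t u x] stu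
      by (simp add: pinned_kernel_def[abs_def])
  next
    case 4
    then have "Kp t u = (\<lambda>_. return borel b)" "Kp s u x = return borel b"
      by (simp_all add: pinned_kernel_def[abs_def])
    then show ?thesis
      using bind_const'[of "Kp s t x" "return borel b"] st
      by (simp add: space_prob_algebra prob_space_return prob_space_imp_subprob_space)
  qed
qed

lemma measure_pinned_kernel:
  assumes st: "0 \<le> s" "s < t" "t < T" and A: "A \<in> sets borel"
  shows "measure (Kp s t x) A = (LINT y:A|\<mu>. p s t x y)"
proof -
  have [measurable]: "A \<in> sets \<mu>" using A by (simp add: sets_base)
  have [measurable]: "(\<lambda>y. ennreal (p s t x y)) \<in> borel_measurable \<mu>" "p s t x \<in> borel_measurable \<mu>"
    using measurable_compose[OF measurable_Pair1'[of x borel \<mu>] p_measurable_base[OF st]]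
      measurable_compose[OF measurable_Pair1'[of x borel borel] p_measurable[OF st]]
    by (simp_all add: measurable_base)
  have "(LINT y:A|\<mu>. p s t x y) = enn2real (\<integral>\<^sup>+y. ennreal (indicator A y * p s t x y) \<partial>\<mu>)"
    unfolding set_lebesgue_integral_def real_scaleR_def
    using p_nonneg[OF st] by (intro integral_eq_nn_integral) auto
  also have "(\<integral>\<^sup>+y. ennreal (indicator A y * p s t x y) \<partial>\<mu>) = emeasure (Kp s t x) A"
    using st by (simp add: pinned_kernel_def emeasure_density)
      (auto intro!: nn_integral_cong split: split_indicator)
  finally show ?thesis by (simp add: measure_def)
qed

text \<open>
  The definition of a bridge prescribes transition probabilities only between times below \<open>T\<close>. Those
  to the terminal time come for free, because the terminal state is almost surely the constant \<open>b\<close>;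
  conversely the kernel \<open>\<delta>\<^sub>b\<close> from time \<open>0\<close> to \<open>T\<close> forces the terminal state to be
  \<open>b\<close>.
\<close>

lemma is_bridge_iff_markov_from:
  assumes p: "p = bridge_density \<mu> q T b"
  shows "is_bridge \<mu> q T a b N Y \<longleftrightarrow> markov_from N Y a"
proof
  assume br: "is_bridge \<mu> q T a b N Y"
  then interpret prob_space N by (simp add: is_bridge_def markov_process_def)
  have Y: "Y t \<in> N \<rightarrow>\<^sub>M borel" if "t \<in> {0..T}" for t
    using br that by (simp add: is_bridge_def markov_process_def)
  have [measurable]: "Y 0 \<in> N \<rightarrow>\<^sub>M borel" "Y T \<in> N \<rightarrow>\<^sub>M borel" using Y T_pos by auto
  have start: "AE \<omega> in N. Y 0 \<omega> = a" and "end": "AE \<omega> in N. Y T \<omega> = b"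
    using br by (auto simp: is_bridge_def prob_Collect_eq_1)
  have "emeasure N (B \<inter> {\<omega> \<in> space N. Y t \<omega> \<in> A}) = (\<integral>\<^sup>+\<omega>\<in>B. emeasure (Kp s t (Y s \<omega>)) A \<partial>N)"
    if st: "0 \<le> s" "s \<le> t" "t \<le> T" and A: "A \<in> sets borel" and B: "B \<in> sets (gen_by N Y {0..s})"
    for s t A B
  proof -
    let ?V = "{\<omega> \<in> space N. Y t \<omega> \<in> A}"
    have sub: "subalgebra N (gen_by N Y {0..s})"
      using st by (intro subalgebra_gen_by Y) auto
    have [measurable]: "B \<in> sets N" "Y t \<in> N \<rightarrow>\<^sub>M borel"
      using sub B Y st by (auto simp: subalgebra_def)
    note A [measurable]
    have V: "emeasure N (B \<inter> ?V) = (\<integral>\<^sup>+\<omega>\<in>B. indicator A (Y t \<omega>) \<partial>N)"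
    proof -
      have "emeasure N (B \<inter> ?V) = (\<integral>\<^sup>+\<omega>. indicator (B \<inter> ?V) \<omega> \<partial>N)" by simp
      also have "\<dots> = (\<integral>\<^sup>+\<omega>\<in>B. indicator A (Y t \<omega>) \<partial>N)"
        by (intro nn_integral_cong) (auto split: split_indicator)
      finally show ?thesis .
    qed
    consider "s = t" | "s < t" "t < T" | "s < t" "t = T" using st by linarith
    then show ?thesis
    proof cases
      case 1
      then show ?thesis using V by (simp add: pinned_kernel_def A)
    next
      case 2
      let ?h = "\<lambda>\<omega>. measure (Kp s t (Y s \<omega>)) A"
      have h: "?h \<in> borel_measurable (gen_by N Y {0..s})"
        using measurable_compose[OF measurable_gen_by[of s "{0..s}" Y N] measurable_compose[OF kernel[OF st] measurable_measure_prob_algebra[OF A]]] st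
        by simp
      have "AE \<omega> in N. cond_prob_in N (gen_by N Y {0..s}) (Y t) A \<omega> = ?h \<omega>"
        using br st 2 A by (simp add: is_bridge_def measure_pinned_kernel p[symmetric])
      then have "emeasure N (B \<inter> ?V) = (\<integral>\<^sup>+\<omega>\<in>B. ennreal (?h \<omega>) \<partial>N)"
        using cond_prob_in_iff[OF prob_space_axioms sub _ A h, of "Y t"] B
          prob_space.prob_le_1[OF prob_space_kernel[OF st]] by simp
      then show ?thesis
        by (simp add: finite_measure.emeasure_eq_measure[OF prob_space.finite_measure[OF prob_space_kernel[OF st]]])
    next
      case 3
      have "(\<integral>\<^sup>+\<omega>\<in>B. indicator A (Y t \<omega>) \<partial>N) = (\<integral>\<^sup>+\<omega>\<in>B. emeasure (Kp s t (Y s \<omega>)) A \<partial>N)"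
        using "end" 3 by (intro nn_integral_cong_AE) (auto simp: pinned_kernel_def A)
      then show ?thesis using V by simp
    qed
  qed
  then show "markov_from N Y a"
    using start Y prob_space_axioms unfolding markov_from_def by blast
next
  assume mk: "markov_from N Y a"
  then interpret prob_space N by (simp add: markov_from_def)
  have Y: "Y t \<in> N \<rightarrow>\<^sub>M borel" if "t \<in> {0..T}" for t
    using mk that by (simp add: markov_from_def)
  have [measurable]: "Y 0 \<in> N \<rightarrow>\<^sub>M borel" "Y T \<in> N \<rightarrow>\<^sub>M borel" using Y T_pos by auto
  have cond: "AE \<omega> in N. cond_prob_in N (gen_by N Y I) (Y t) A \<omega> = measure (Kp s t (Y s \<omega>)) A"
    if "0 \<le> s" "s \<le> t" "t \<le> T" "s \<in> I" "I \<subseteq> {0..s}" "A \<in> sets borel" for s t I A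
    by (rule markov_from_cond_prob[OF mk that])
  have "AE \<omega> in N. cond_prob_in N (gen_by N Y {0..s}) (Y t) A \<omega> = cond_prob_in N (gen_by N Y {s}) (Y t) A \<omega>"
    if "0 \<le> s" "s \<le> t" "t \<le> T" "A \<in> sets borel" for s t A
    using cond[of s t "{0..s}" A] cond[of s t "{s}" A] that by auto
  then have "markov_process N T Y"
    using Y prob_space_axioms by (auto simp: markov_process_def)
  moreover have "\<P>(\<omega> in N. Y 0 \<omega> = a) = 1"
    using mk by (simp add: prob_Collect_eq_1 markov_from_def)
  moreover have "\<P>(\<omega> in N. Y T \<omega> = b) = 1"
  proof -
    have "emeasure N (space N \<inter> {\<omega> \<in> space N. Y T \<omega> \<in> {b}}) =
        (\<integral>\<^sup>+\<omega>\<in>space N. emeasure (Kp 0 T (Y 0 \<omega>)) {b} \<partial>N)"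
    proof -
      have B: "space N \<in> sets (gen_by N Y {0..0})"
        using sets.top[of "gen_by N Y {0..0}"] by simp
      have "0 \<le> T" "{b} \<in> sets borel" using T_pos by auto
      with B show ?thesis using mk unfolding markov_from_def by blast
    qed
    also have "\<dots> = 1"
      using T_pos by (simp add: pinned_kernel_def emeasure_space_1)
    finally show ?thesis by (simp add: emeasure_eq_measure Int_def)
  qed
  moreover have "AE \<omega> in N. cond_prob_in N (gen_by N Y {0..s}) (Y t) A \<omega> =
      (LINT y:A|\<mu>. bridge_density \<mu> q T b s t (Y s \<omega>) y)"
    if "0 \<le> s" "s < t" "t < T" "A \<in> sets borel" for s t A
    using cond[of s t "{0..s}" A] that by (simp add: measure_pinned_kernel p[symmetric])
  ultimately show "is_bridge \<mu> q T a b N Y" by (simp add: is_bridge_def)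
qed

end

section \<open>Existence and uniqueness of the bridge\<close>

theorem lemma2p2:
  fixes \<mu> :: "'e::polish_space measure"
    and T :: real and a b :: 'e
    and M :: "'w measure" and Z :: "real \<Rightarrow> 'w \<Rightarrow> 'e"
    and pZ :: "real \<Rightarrow> 'e \<Rightarrow> 'e \<Rightarrow> real"
    and p :: "real \<Rightarrow> real \<Rightarrow> 'e \<Rightarrow> 'e \<Rightarrow> real"
  defines "p \<equiv> bridge_density \<mu> pZ T b"
  assumes T: "0 < T"
    and mu: "sets \<mu> = sets borel" "sigma_finite_measure \<mu>"
    and Z: "markov_process M T Z" "homogeneous_transition_densities M T Z \<mu> pZ"
    and meas: "\<And>s t. 0 \<le> s \<Longrightarrow> s < t \<Longrightarrow> t < T \<Longrightarrow>
      (\<lambda>(x, y). p s t x y) \<in> borel_measurable (borel \<Otimes>\<^sub>M borel)"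
    and dens: "\<And>s t x. 0 \<le> s \<Longrightarrow> s < t \<Longrightarrow> t < T \<Longrightarrow>
      (\<forall>y. 0 \<le> p s t x y) \<and> p s t x \<in> borel_measurable \<mu> \<and>
      (\<integral>\<^sup>+ y. ennreal (p s t x y) \<partial>\<mu>) = 1"
    and CK: "\<And>s t u x z. 0 \<le> s \<Longrightarrow> s < t \<Longrightarrow> t < u \<Longrightarrow> u < T \<Longrightarrow>
      ennreal (p s u x z) = (\<integral>\<^sup>+ y. ennreal (p s t x y * p t u y z) \<partial>\<mu>)"
  shows "(\<exists>!P. is_bridge_measure \<mu> pZ T a b P) \<and>
    (\<forall>(N :: 'v measure) Y. is_bridge \<mu> pZ T a b N Y \<longrightarrow>
       path_law N T Y = bridge_measure \<mu> pZ T a b)"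
proof -
  interpret pinned_densities \<mu> p T b
    using T mu meas dens CK
    by (intro pinned_densities.intro pinned_densities_axioms.intro) blast+
  have p: "p = bridge_density \<mu> pZ T b" by (simp add: p_def)
  have bridge_fdd: "has_fdd N Y a" if "is_bridge \<mu> pZ T a b N Y" for N :: "'v measure" and Y
    using that by (intro markov_from_imp_has_fdd) (simp add: is_bridge_iff_markov_from[OF p])
  obtain P where P: "prob_space P" "sets P = sets (path_space T)" "has_fdd P (\<lambda>t \<omega>. \<omega> t) a"
    using ex_measure_has_fdd[of a] by blast
  have P_bridge: "is_bridge_measure \<mu> pZ T a b P"
    using P has_fdd_imp_markov_from[OF P(3)]
    by (simp add: is_bridge_measure_def is_bridge_iff_markov_from[OF p])
  have unique: "Q = P" if "is_bridge_measure \<mu> pZ T a b Q" for Q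
  proof -
    have Q: "sets Q = sets (path_space T)" "has_fdd Q (\<lambda>t \<omega>. \<omega> t) a"
      using that markov_from_imp_has_fdd
      by (auto simp: is_bridge_measure_def is_bridge_iff_markov_from[OF p])
    \<comment> \<open>A measure on path space is the law of its own coordinate process.\<close>
    have "Q = path_law Q T (\<lambda>t \<omega>. \<omega> t)" using path_law_eq[OF Q(2) Q(2,1)] by simp
    also have "\<dots> = P" by (rule path_law_eq[OF Q(2) P(3,2)])
    finally show ?thesis .
  qed
  have "bridge_measure \<mu> pZ T a b = P"
    unfolding bridge_measure_def using P_bridge unique by (rule the_equality)
  moreover have "path_law N T Y = P" if "is_bridge \<mu> pZ T a b N Y" for N :: "'v measure" and Y
    by (rule path_law_eq[OF bridge_fdd[OF that] P(3,2)])
  moreover have "\<exists>!P. is_bridge_measure \<mu> pZ T a b P"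
    using P_bridge by (rule ex1I) (rule unique)
  ultimately show ?thesis by blast
qed

end
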